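(* Every hat (basic or triangulated) with valid parameters $\alpha,\beta,\gamma$ satisfying $\alpha>2\beta+\gamma$ (with $\gamma=0$ for basic hats) is an open convex-faced polyhedron with no edge unfolding.
   Context: A polyhedron is a connected set of closed planar polygons in $\mathbb{R}^3$ such that any intersection of two of them is a collection of common vertices and edges, and each edge is shared by at most two polygons; it is open if some edge belongs to only one polygon (boundary edges). Convex-faced: every face has all interior angles strictly less than $\pi$. A cutting of $P$ is a union $C$ of finitely many line segments on $P$, containing only finitely many boundary points of $P$, such that $P-C$ is connected and can be isometrically embedded in the plane without overlap; an edge cutting is a cutting that is a union of edges of $P$, and the result is an edge unfolding. Hats: open polyhedra with equilateral-triangle boundary; boundary vertices are corners, the innermost vertex is the tip, and there are three middle vertices. The spike consists of the three triangles incident to the tip: congruent isosceles triangles with base angles $\alpha$ and unit base edges, whose base vertices are the middle vertices. Basic hat: $30^\circ\le\alpha,\beta<90^\circ$, $\ell>1$, $\gamma=0$; brim = three congruent symmetric trapezoids with lower angles $\beta$, top side a spike base edge (length 1), bottom side a boundary edge (length $\ell$). Triangulated hat: $30^\circ\le\alpha<90^\circ$, $30^\circ\le\beta+\gamma/2<90^\circ$, $\gamma<60^\circ$; brim = three congruent isosceles triangles with bases the boundary edges, base angles $\beta$ and apex at a middle vertex, plus three congruent isosceles triangles with bases the spike base edges and apex angle $\gamma$ at a corner. Valid parameters are those satisfying these constraints. *)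

theory Defs
  imports "HOL-Analysis.Analysis"
begin

definition vangle :: "'a::real_inner \<Rightarrow> 'a \<Rightarrow> real" where
  "vangle u v = arccos ((inner u v) / (norm u * norm v))"

definition nxt :: "'a list \<Rightarrow> nat \<Rightarrow> 'a" where
  "nxt vs i = vs ! (Suc i mod length vs)"

definition prv :: "'a list \<Rightarrow> nat \<Rightarrow> 'a" where
  "prv vs i = vs ! ((i + length vs - 1) mod length vs)"

definition poly_edges :: "(real^3) list \<Rightarrow> (real^3) set set" where
  "poly_edges vs = {{vs ! i, nxt vs i} | i. i < length vs}"

definition poly_boundary :: "(real^3) list \<Rightarrow> (real^3) set" where
  "poly_boundary vs = (\<Union>i<length vs. closed_segment (vs ! i) (nxt vs i))"

definition simple_polygon :: "(real^3) list \<Rightarrow> bool" where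
  "simple_polygon vs \<longleftrightarrow> length vs \<ge> 3 \<and> distinct vs \<and> aff_dim (set vs) = 2 \<and>
     (\<forall>i<length vs. \<forall>j<length vs. i \<noteq> j \<longrightarrow>
        closed_segment (vs ! i) (nxt vs i) \<inter> closed_segment (vs ! j) (nxt vs j) =
          (if j = Suc i mod length vs then {vs ! j}
           else if i = Suc j mod length vs then {vs ! i} else {}))"

definition poly_region :: "(real^3) list \<Rightarrow> (real^3) set" where
  "poly_region vs = (let B = poly_boundary vs; A = affine hull (set vs) in
      B \<union> {x \<in> A - B. bounded (connected_component_set (A - B) x)})"

definition interior_angle :: "(real^3) list \<Rightarrow> nat \<Rightarrow> real" where
  "interior_angle vs i = (let v = vs ! i; a = prv vs i - v; b = nxt vs i - v;
       d = (1 / norm a) *\<^sub>R a + (1 / norm b) *\<^sub>R b in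
     if (\<exists>e>0. \<forall>s. 0 < s \<and> s < e \<longrightarrow> v + s *\<^sub>R d \<in> poly_region vs)
     then vangle a b else 2 * pi - vangle a b)"

definition faces_with_edge :: "(real^3) list set \<Rightarrow> (real^3) set \<Rightarrow> (real^3) list set" where
  "faces_with_edge P e = {F \<in> P. e \<in> poly_edges F}"

definition surface :: "(real^3) list set \<Rightarrow> (real^3) set" where
  "surface P = (\<Union>F\<in>P. poly_region F)"

definition is_polyhedron :: "(real^3) list set \<Rightarrow> bool" where
  "is_polyhedron P \<longleftrightarrow> finite P \<and> P \<noteq> {} \<and> (\<forall>F\<in>P. simple_polygon F) \<and>
     connected (surface P) \<and>
     (\<forall>F\<in>P. \<forall>G\<in>P. F \<noteq> G \<longrightarrow>
        (\<exists>V E. V \<subseteq> set F \<inter> set G \<and> E \<subseteq> poly_edges F \<inter> poly_edges G \<and>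
               poly_region F \<inter> poly_region G = V \<union> \<Union> ((\<lambda>e. convex hull e) ` E))) \<and>
     (\<forall>e. card (faces_with_edge P e) \<le> 2)"

definition polyhedron_edges :: "(real^3) list set \<Rightarrow> (real^3) set set" where
  "polyhedron_edges P = (\<Union>F\<in>P. poly_edges F)"

definition boundary_edges :: "(real^3) list set \<Rightarrow> (real^3) set set" where
  "boundary_edges P = {e \<in> polyhedron_edges P. card (faces_with_edge P e) = 1}"

definition boundary_points :: "(real^3) list set \<Rightarrow> (real^3) set" where
  "boundary_points P = (\<Union>e\<in>boundary_edges P. convex hull e)"

definition open_polyhedron :: "(real^3) list set \<Rightarrow> bool" where
  "open_polyhedron P \<longleftrightarrow> is_polyhedron P \<and> boundary_edges P \<noteq> {}"

definition convex_faced :: "(real^3) list set \<Rightarrow> bool" where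
  "convex_faced P \<longleftrightarrow> (\<forall>F\<in>P. \<forall>i<length F. interior_angle F i < pi)"

text \<open>An isometric embedding of P - C into the plane without overlap: an injective map
  which is distance preserving on every piece of every face left after cutting.\<close>
definition unfolding_map :: "(real^3) list set \<Rightarrow> (real^3) set \<Rightarrow> (real^3 \<Rightarrow> real^2) \<Rightarrow> bool" where
  "unfolding_map P C f \<longleftrightarrow> inj_on f (surface P - C) \<and>
     (\<forall>F\<in>P. \<forall>K\<in>components (poly_region F - C). \<forall>x\<in>K. \<forall>y\<in>K. dist (f x) (f y) = dist x y)"

definition cutting :: "(real^3) list set \<Rightarrow> (real^3) set \<Rightarrow> bool" where
  "cutting P C \<longleftrightarrow>
     (\<exists>S. finite S \<and> (\<forall>s\<in>S. \<exists>a b. s = closed_segment a b) \<and> C = \<Union>S) \<and>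
     C \<subseteq> surface P \<and> finite (C \<inter> boundary_points P) \<and>
     connected (surface P - C) \<and> (\<exists>f. unfolding_map P C f)"

definition edge_cutting :: "(real^3) list set \<Rightarrow> (real^3) set \<Rightarrow> bool" where
  "edge_cutting P C \<longleftrightarrow> cutting P C \<and>
     (\<exists>E \<subseteq> polyhedron_edges P. C = (\<Union>e\<in>E. convex hull e))"

definition has_edge_unfolding :: "(real^3) list set \<Rightarrow> bool" where
  "has_edge_unfolding P \<longleftrightarrow> (\<exists>C. edge_cutting P C)"

text \<open>Tip t, middle vertices m 0, m 1, m 2, corners c 0, c 1, c 2 (indices mod 3).\<close>

definition spike_faces :: "real^3 \<Rightarrow> (nat \<Rightarrow> real^3) \<Rightarrow> (real^3) list set" where
  "spike_faces t m = {[t, m i, m (Suc i mod 3)] | i. i < 3}"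

definition basic_hat_faces :: "real^3 \<Rightarrow> (nat \<Rightarrow> real^3) \<Rightarrow> (nat \<Rightarrow> real^3) \<Rightarrow> (real^3) list set" where
  "basic_hat_faces t m c = spike_faces t m \<union>
     {[m i, m (Suc i mod 3), c (Suc i mod 3), c i] | i. i < 3}"

definition tri_hat_faces :: "real^3 \<Rightarrow> (nat \<Rightarrow> real^3) \<Rightarrow> (nat \<Rightarrow> real^3) \<Rightarrow> (real^3) list set" where
  "tri_hat_faces t m c = spike_faces t m \<union>
     {[m i, m (Suc i mod 3), c i] | i. i < 3} \<union>
     {[c i, c (Suc i mod 3), m (Suc i mod 3)] | i. i < 3}"

definition spike_ok :: "real^3 \<Rightarrow> (nat \<Rightarrow> real^3) \<Rightarrow> real \<Rightarrow> bool" where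
  "spike_ok t m \<alpha> \<longleftrightarrow> (\<forall>i<3. let j = Suc i mod 3 in
      dist (m i) (m j) = 1 \<and> vangle (t - m i) (m j - m i) = \<alpha> \<and> vangle (t - m j) (m i - m j) = \<alpha>)"

definition basic_hat :: "real^3 \<Rightarrow> (nat \<Rightarrow> real^3) \<Rightarrow> (nat \<Rightarrow> real^3) \<Rightarrow> real \<Rightarrow> real \<Rightarrow> real \<Rightarrow> bool" where
  "basic_hat t m c \<alpha> \<beta> l \<longleftrightarrow>
     pi/6 \<le> \<alpha> \<and> \<alpha> < pi/2 \<and> pi/6 \<le> \<beta> \<and> \<beta> < pi/2 \<and> l > 1 \<and>
     is_polyhedron (basic_hat_faces t m c) \<and> spike_ok t m \<alpha> \<and>
     (\<forall>i<3. let j = Suc i mod 3 in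
        dist (c i) (c j) = l \<and> c j - c i = l *\<^sub>R (m j - m i) \<and>
        vangle (m i - c i) (c j - c i) = \<beta> \<and> vangle (m j - c j) (c i - c j) = \<beta>)"

definition triangulated_hat :: "real^3 \<Rightarrow> (nat \<Rightarrow> real^3) \<Rightarrow> (nat \<Rightarrow> real^3) \<Rightarrow> real \<Rightarrow> real \<Rightarrow> real \<Rightarrow> bool" where
  "triangulated_hat t m c \<alpha> \<beta> \<gamma> \<longleftrightarrow>
     pi/6 \<le> \<alpha> \<and> \<alpha> < pi/2 \<and> pi/6 \<le> \<beta> + \<gamma>/2 \<and> \<beta> + \<gamma>/2 < pi/2 \<and> \<gamma> < pi/3 \<and>
     is_polyhedron (tri_hat_faces t m c) \<and> spike_ok t m \<alpha> \<and>
     dist (c 0) (c 1) = dist (c 1) (c 2) \<and> dist (c 1) (c 2) = dist (c 2) (c 0) \<and>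
     (\<forall>i<3. let j = Suc i mod 3 in
        dist (c i) (m i) = dist (c i) (m j) \<and> vangle (m i - c i) (m j - c i) = \<gamma> \<and>
        vangle (m j - c i) (c j - c i) = \<beta> \<and> vangle (m j - c j) (c i - c j) = \<beta>)"

end

theory Submission
  imports Defs
begin

text \<open>
  An unfolding is isometric on every face minus the cuts, so on two faces that share an uncut edge
  it agrees along that edge, and injectivity forbids folding there. Hence faces that follow each
  other around a vertex, with no cut between them, are laid out side by side around one point of
  the plane, and their angles at the vertex add up to at most \<open>2\<pi>\<close>.

  The faces at a middle vertex have total angle \<open>2\<pi> + 2\<alpha> - 2\<beta> - \<gamma> > 2\<pi>\<close>. Even without one of
  the two spike triangles the angle is \<open>2\<pi> + \<alpha> - 2\<beta> - \<gamma> > 2\<pi>\<close>. So at least two edges are cut at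
  every middle vertex, and they are not just the edge to the tip and one spike base edge. Since the
  surface stays connected, the cuts contain no cycle and no path between two corners; identifying
  the corners, they form a forest whose only possible leaves are the tip and the corner point. Such
  a forest that reaches all middle vertices is a path that runs from the tip through the three
  middle vertices to a corner, and this path uses the forbidden pair of cuts at the first middle
  vertex.
\<close>

text \<open>The definition of an unfolding grants little: distances are kept only within a component
  of a single face minus the cuts, orientation is free, and the vertex of a fan may itself be cut
  away. So the proof works with punctured corners, recovers the image of the vertex as the centre
  about which they turn, and has to derive that neighbouring corners have equal orientation.

  The hypothesis \<alpha> > 2\<beta> + \<gamma> says exactly that the angle at a middle vertex still
  exceeds 2\<pi> after one spike triangle is left out: the brim contributes 2(\<pi> - \<beta>) in a
  basic hat and (\<pi> - \<gamma>) + (\<pi> - 2\<beta>) in a triangulated one.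

  Neither the Jordan curve theorem nor a graph of cuts appears. The faces are convex, so half-planes
  describe their regions; a closed chain of cuts separates because it splits the faces into two
  groups with closed unions that meet only in cuts. A chain between two corners does the same, since
  the boundary closes it up. The forest argument becomes a finite list of such chains and a
  propositional case distinction.\<close>

section \<open>Convex polygons\<close>

text \<open>The inequality \<open>b k \<le> a k \<bullet> x\<close> describes the half-plane bounded by the line
  through the \<open>k\<close>-th edge.\<close>

definition edge_halfplanes :: "(real^3) list \<Rightarrow> (nat \<Rightarrow> real^3) \<Rightarrow> (nat \<Rightarrow> real) \<Rightarrow> bool" where
  "edge_halfplanes vs a b \<longleftrightarrow>
     (\<forall>k<length vs. \<forall>j<length vs. b k \<le> a k \<bullet> vs ! j \<and>
        (a k \<bullet> vs ! j = b k \<longleftrightarrow> j = k \<or> j = Suc k mod length vs)) \<and>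
     (\<forall>x\<in>affine hull set vs. (\<forall>k<length vs. b k \<le> a k \<bullet> x) \<longrightarrow> x \<in> convex hull set vs)"

text \<open>The equality clause of \<open>edge_halfplanes\<close> makes this strict convexity: a
  side functional is tight at two vertices only, which keeps every angle strictly between 0 and
  \<pi>.\<close>

definition convex_polygon :: "(real^3) list \<Rightarrow> bool" where
  "convex_polygon vs \<longleftrightarrow> 3 \<le> length vs \<and> distinct vs \<and> (\<exists>a b. edge_halfplanes vs a b)"

text \<open>With \<open>simp only\<close>, these unfold a quantifier over the indices of a literal
  list into one condition per index.\<close>

lemmas all_list_index_simps =
  list.size All_less_Suc simp_thms add_0 add_Suc_right add_0_right nth_Cons_0 nth_Cons_Suc not_less0

lemma poly_edges_simps:
  "poly_edges [x, y, z] = {{x, y}, {y, z}, {z, x}}"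
  "poly_edges [x, y, z, w] = {{x, y}, {y, z}, {z, w}, {w, x}}"
proof -
  have *: "poly_edges vs = (\<lambda>i. {vs ! i, nxt vs i}) ` {..<length vs}" for vs
    unfolding poly_edges_def by auto
  show "poly_edges [x, y, z] = {{x, y}, {y, z}, {z, x}}"
    "poly_edges [x, y, z, w] = {{x, y}, {y, z}, {z, w}, {w, x}}"
    unfolding * by (simp_all add: nxt_def lessThan_Suc insert_commute)
qed

text \<open>\<open>?D\<close> is the Gram determinant, nonzero by the equality case of
  Cauchy-Schwarz; the witnesses come from the inverse Gram matrix. They read off coordinates in the
  plane of a polygon.\<close>

lemma dual_basis:
  fixes p q :: "'a::real_inner"
  assumes "\<not> collinear {0, p, q}"
  obtains a b where "a \<bullet> p = 1" "a \<bullet> q = 0" "b \<bullet> p = 0" "b \<bullet> q = 1"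
proof -
  let ?D = "(p \<bullet> p) * (q \<bullet> q) - (p \<bullet> q)\<^sup>2"
  have "\<bar>p \<bullet> q\<bar> \<noteq> norm p * norm q"
    using assms norm_cauchy_schwarz_equal by blast
  hence "(p \<bullet> q)\<^sup>2 \<noteq> (norm p * norm q)\<^sup>2"
    by (metis abs_ge_zero mult_nonneg_nonneg norm_ge_zero power2_abs power2_eq_imp_eq)
  hence D: "?D \<noteq> 0" by (simp add: power_mult_distrib power2_norm_eq_inner)
  show ?thesis
  proof (rule that)
    show "((1 / ?D) *\<^sub>R ((q \<bullet> q) *\<^sub>R p - (p \<bullet> q) *\<^sub>R q)) \<bullet> p = 1"
      using D by (simp add: inner_diff_left power2_eq_square inner_commute[of q p] mult.commute)
    show "((1 / ?D) *\<^sub>R ((p \<bullet> p) *\<^sub>R q - (p \<bullet> q) *\<^sub>R p)) \<bullet> q = 1"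
      using D by (simp add: inner_diff_left power2_eq_square)
  qed (simp_all add: inner_diff_left inner_commute[of q p] mult.commute)
qed

lemma affine_hull_3_coords:
  fixes D p q :: "'a::real_vector"
  assumes "x \<in> affine hull {D, D + p, D + q}"
  obtains s r where "x = D + s *\<^sub>R p + r *\<^sub>R q"
proof -
  obtain u v w where "x = u *\<^sub>R D + v *\<^sub>R (D + p) + w *\<^sub>R (D + q)" "u + v + w = 1"
    using assms unfolding affine_hull_3 by auto
  moreover have "u *\<^sub>R D + v *\<^sub>R (D + p) + w *\<^sub>R (D + q) = (u + v + w) *\<^sub>R D + v *\<^sub>R p + w *\<^sub>R q"
    by (simp add: algebra_simps)
  ultimately show ?thesis using that[of v w] by simp
qed

lemma convex_polygon_triangle:
  assumes "simple_polygon [x, y, z]"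
  shows "convex_polygon [x, y, z]"
proof -
  define p q where "p = y - x" and "q = z - x"
  have y: "y = x + p" and z: "z = x + q" by (simp_all add: p_def q_def)
  have "aff_dim {x, y, z} = 2" and dist: "distinct [x, y, z]"
    using assms by (auto simp: simple_polygon_def)
  hence "\<not> collinear {x, y, z}" by (simp add: collinear_aff_dim)
  hence "\<not> collinear {0, p, q}"
    using collinear_3[of y x z] by (simp add: p_def q_def insert_commute)
  then obtain a b where ab: "a \<bullet> p = 1" "a \<bullet> q = 0" "b \<bullet> p = 0" "b \<bullet> q = 1"
    by (rule dual_basis)
  \<comment> \<open>Up to constants, the barycentric coordinates belonging to \<open>z\<close>,
    \<open>x\<close> and \<open>y\<close>: each vanishes on the side opposite its vertex.\<close>
  let ?a = "(!) [b, - a - b, a]" and ?b = "(!) [b \<bullet> x, - 1 - a \<bullet> x - b \<bullet> x, a \<bullet> x]"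
  have 1: "\<forall>k<length [x,y,z]. \<forall>j<length [x,y,z]. ?b k \<le> ?a k \<bullet> [x,y,z] ! j \<and>
              (?a k \<bullet> [x,y,z] ! j = ?b k \<longleftrightarrow> j = k \<or> j = Suc k mod length [x,y,z])"
    using ab by (simp only: all_list_index_simps) (simp add: y z inner_simps)
  have 2: "u \<in> convex hull set [x,y,z]" if hull: "u \<in> affine hull set [x,y,z]"
    and k: "\<forall>k<length [x,y,z]. ?b k \<le> ?a k \<bullet> u" for u
  proof -
    obtain s r where u: "u = x + s *\<^sub>R p + r *\<^sub>R q"
      using hull affine_hull_3_coords[of u x p q] by (auto simp: y z)
    have "0 \<le> s" "0 \<le> r" "s + r \<le> 1"
      using k ab by (simp_all only: all_list_index_simps) (simp_all add: u inner_simps)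
    moreover have "u = (1 - s - r) *\<^sub>R x + s *\<^sub>R y + r *\<^sub>R z"
      by (simp add: u y z algebra_simps)
    ultimately show ?thesis unfolding list.set convex_hull_3
      by (intro CollectI exI[of _ "1 - s - r"] exI[of _ s] exI[of _ r]) auto
  qed
  show ?thesis unfolding convex_polygon_def edge_halfplanes_def
    using dist by (intro conjI exI[of _ ?a] exI[of _ ?b] 1 ballI impI 2) auto
qed

lemma convex_polygon_trapezoid:
  assumes "simple_polygon [A, B, C, D]" and par: "C - D = l *\<^sub>R (B - A)" and l: "l > 0"
  shows "convex_polygon [A, B, C, D]"
proof -
  define p q where "p = C - D" and "q = A - D"
  have C: "C = D + p" and A: "A = D + q" by (simp_all add: p_def q_def)
  have "B - A = (1 / l) *\<^sub>R p" using par l by (simp add: p_def)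
  hence B: "B = D + q + (1 / l) *\<^sub>R p" by (simp add: A algebra_simps)
  have "aff_dim {A, B, C, D} = 2" and dist: "distinct [A, B, C, D]"
    using assms by (auto simp: simple_polygon_def)
  have "B = (- 1 / l) *\<^sub>R D + (1 / l) *\<^sub>R (D + p) + 1 *\<^sub>R (D + q)"
    by (simp add: B algebra_simps)
  hence B_in: "B \<in> affine hull {D, D + p, D + q}"
    unfolding affine_hull_3
    by (intro CollectI exI[of _ "- 1 / l"] exI[of _ "1 / l"] exI[of _ 1]) simp
  hence sub: "affine hull {A, B, C, D} \<subseteq> affine hull {D, D + p, D + q}"
    by (intro hull_minimal) (auto simp: A C intro: hull_inc)
  have "\<not> collinear {D, D + p, D + q}"
  proof
    assume "collinear {D, D + p, D + q}"
    hence "aff_dim {D, D + p, D + q} \<le> 1" by (simp add: collinear_aff_dim)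
    moreover have "aff_dim {A, B, C, D} \<le> aff_dim {D, D + p, D + q}"
      using sub by (metis aff_dim_affine_hull aff_dim_subset)
    ultimately show False using \<open>aff_dim {A, B, C, D} = 2\<close> by simp
  qed
  hence "\<not> collinear {0, p, q}"
    using collinear_3[of "D + p" D "D + q"] by (simp add: insert_commute)
  then obtain a b where ab: "a \<bullet> p = 1" "a \<bullet> q = 0" "b \<bullet> p = 0" "b \<bullet> q = 1"
    by (rule dual_basis)
  \<comment> \<open>In coordinates along \<open>p\<close> and \<open>q\<close> the leg from
    \<open>B\<close> to \<open>C\<close> is the line s + m r = 1: it passes through (1, 0) at
    \<open>C\<close> and (1/l, 1) at \<open>B\<close>.\<close>
  define m where "m = 1 - 1 / l"
  have m: "m < 1" "1 / l = 1 - m" using l by (simp_all add: m_def)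
  let ?a = "(!) [- b, - a - m *\<^sub>R b, b, a]"
  let ?b = "(!) [- 1 - b \<bullet> D, - 1 - a \<bullet> D - m * (b \<bullet> D), b \<bullet> D, a \<bullet> D]"
  let ?l = "[A, B, C, D]"
  have 1: "\<forall>k<length ?l. \<forall>j<length ?l. ?b k \<le> ?a k \<bullet> ?l ! j \<and>
              (?a k \<bullet> ?l ! j = ?b k \<longleftrightarrow> j = k \<or> j = Suc k mod length ?l)"
    using ab m(1) by (simp only: all_list_index_simps)
      (simp add: A B C m(2) inner_simps algebra_simps)
  have 2: "u \<in> convex hull set ?l" if hull: "u \<in> affine hull set ?l"
    and k: "\<forall>k<length ?l. ?b k \<le> ?a k \<bullet> u" for u
  proof -
    obtain s r where u: "u = D + s *\<^sub>R p + r *\<^sub>R q"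
      using hull sub affine_hull_3_coords[of u D p q] by auto
    have r: "0 \<le> s" "0 \<le> r" "r \<le> 1" "s + m * r \<le> 1"
      using k ab by (simp_all only: all_list_index_simps) (simp_all add: u inner_simps algebra_simps)
    have "m * r < 1"
    proof (cases "r = 0")
      case False
      hence "m * r < 1 * r" using m(1) r by (intro mult_strict_right_mono) auto
      thus ?thesis using r by simp
    qed simp
    hence X: "1 - m * r > 0" by simp
    \<comment> \<open>At height \<open>r\<close> the trapezoid has width 1 - m r in units of
      \<open>p\<close>, and \<open>y\<close> is the relative position across it; so \<open>u\<close>
      lies between two points of the legs.\<close>
    define y where "y = s / (1 - m * r)"
    have y: "0 \<le> y" "y \<le> 1" "s = y * (1 - m * r)" using r X by (simp_all add: y_def)
    have in1: "(1 - r) *\<^sub>R D + r *\<^sub>R A \<in> convex hull set ?l"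
      using r by (intro convexD[OF convex_convex_hull]) (auto intro: hull_inc)
    have in2: "(1 - r) *\<^sub>R C + r *\<^sub>R B \<in> convex hull set ?l"
      using r by (intro convexD[OF convex_convex_hull]) (auto intro: hull_inc)
    have "u = (1 - y) *\<^sub>R ((1 - r) *\<^sub>R D + r *\<^sub>R A) + y *\<^sub>R ((1 - r) *\<^sub>R C + r *\<^sub>R B)"
      by (simp add: u y(3) A B C m algebra_simps)
    thus ?thesis using convexD[OF convex_convex_hull in1 in2, of "1 - y" y] y by simp
  qed
  show ?thesis unfolding convex_polygon_def edge_halfplanes_def
    using dist by (intro conjI exI[of _ ?a] exI[of _ ?b] 1 ballI impI 2) auto
qed

section \<open>Sides, region and corners of a convex polygon\<close>

lemma nxt_neq:
  assumes "distinct vs" "3 \<le> length vs" "i < length vs"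
  shows "Suc i mod length vs \<noteq> i" "nxt vs i \<noteq> vs ! i" "nxt vs i \<in> set vs"
proof -
  show 1: "Suc i mod length vs \<noteq> i"
    using assms by (cases "Suc i = length vs") auto
  have 2: "Suc i mod length vs < length vs" using assms by (intro mod_less_divisor) auto
  show "nxt vs i \<noteq> vs ! i" unfolding nxt_def
    using assms 1 2 by (simp add: nth_eq_iff_index_eq)
  show "nxt vs i \<in> set vs" unfolding nxt_def using 2 by simp
qed

text \<open>In a convex combination with total slack 0, every point with positive slack has weight
  0.\<close>

lemma convex_hull_supporting_hyperplane:
  fixes a :: "'a::euclidean_space"
  assumes "finite S" "\<And>x. x \<in> S \<Longrightarrow> b \<le> a \<bullet> x" "x \<in> convex hull S" "a \<bullet> x = b"
  shows "x \<in> convex hull {y \<in> S. a \<bullet> y = b}"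
proof -
  obtain u where u: "\<forall>y\<in>S. 0 \<le> u y" "sum u S = 1" "(\<Sum>y\<in>S. u y *\<^sub>R y) = x"
    using assms unfolding convex_hull_finite[OF assms(1)] by auto
  have "(\<Sum>y\<in>S. u y * (a \<bullet> y - b)) = a \<bullet> (\<Sum>y\<in>S. u y *\<^sub>R y) - b * sum u S"
    by (simp add: inner_sum_right sum_subtractf sum_distrib_left algebra_simps)
  also have "\<dots> = 0" using u assms by simp
  finally have "\<forall>y\<in>S. u y * (a \<bullet> y - b) = 0"
    using u assms by (subst (asm) sum_nonneg_eq_0_iff) auto
  hence z: "\<forall>y\<in>S - {y \<in> S. a \<bullet> y = b}. u y = 0" by auto
  let ?T = "{y \<in> S. a \<bullet> y = b}"
  have "sum u ?T = 1" "(\<Sum>y\<in>?T. u y *\<^sub>R y) = x"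
    using u z assms(1) by (subst sum.mono_neutral_left[of S]; auto)+
  thus ?thesis using u assms(1) by (subst convex_hull_finite) auto
qed

text \<open>By the last clause a side is the face of the hull exposed by its functional, which turns
  membership in the boundary into an equation.\<close>

lemma edge_halfplanes_D:
  assumes "convex_polygon vs" "edge_halfplanes vs a b"
  shows "\<And>k x. k < length vs \<Longrightarrow> x \<in> convex hull set vs \<Longrightarrow> b k \<le> a k \<bullet> x"
    "\<And>k j. k < length vs \<Longrightarrow> j < length vs \<Longrightarrow> a k \<bullet> vs ! j = b k \<longleftrightarrow> j = k \<or> j = Suc k mod length vs"
    "\<And>x. x \<in> affine hull set vs \<Longrightarrow> (\<And>k. k < length vs \<Longrightarrow> b k \<le> a k \<bullet> x) \<Longrightarrow> x \<in> convex hull set vs"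
    "\<And>k x. k < length vs \<Longrightarrow>
       x \<in> closed_segment (vs ! k) (nxt vs k) \<longleftrightarrow> x \<in> convex hull set vs \<and> a k \<bullet> x = b k"
proof -
  show 2: "a k \<bullet> vs ! j = b k \<longleftrightarrow> j = k \<or> j = Suc k mod length vs"
    if "k < length vs" "j < length vs" for k j
    using assms(2) that by (simp add: edge_halfplanes_def)
  show 3: "x \<in> convex hull set vs"
    if "x \<in> affine hull set vs" "\<And>k. k < length vs \<Longrightarrow> b k \<le> a k \<bullet> x" for x
    using assms(2) that by (simp add: edge_halfplanes_def)
  have 1: "b k \<le> a k \<bullet> vs ! j" if "k < length vs" "j < length vs" for k j
    using assms(2) that by (simp add: edge_halfplanes_def)
  have n: "3 \<le> length vs" "distinct vs" using assms by (auto simp: convex_polygon_def)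
  show 4: "b k \<le> a k \<bullet> x" if "k < length vs" "x \<in> convex hull set vs" for k x
  proof -
    have "convex hull set vs \<subseteq> {x. b k \<le> a k \<bullet> x}"
      using 1 that(1) by (intro hull_minimal convex_halfspace_ge) (auto simp: in_set_conv_nth)
    thus ?thesis using that by auto
  qed
  show 5: "x \<in> closed_segment (vs ! k) (nxt vs k) \<longleftrightarrow> x \<in> convex hull set vs \<and> a k \<bullet> x = b k"
    if k: "k < length vs" for k x
  proof
    have kk: "Suc k mod length vs < length vs" using k by (intro mod_less_divisor) auto
    assume x: "x \<in> closed_segment (vs ! k) (nxt vs k)"
    have "x \<in> convex hull set vs"
      using x nxt_neq[OF n(2,1) k] k hull_mono[of "{vs ! k, nxt vs k}" "set vs" convex]
      by (auto simp: segment_convex_hull)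
    moreover have "closed_segment (vs ! k) (nxt vs k) \<subseteq> {x. a k \<bullet> x = b k}"
      using 2[OF k k] 2[OF k kk] unfolding segment_convex_hull
      by (intro hull_minimal convex_hyperplane) (auto simp: nxt_def)
    ultimately show "x \<in> convex hull set vs \<and> a k \<bullet> x = b k" using x by auto
  next
    assume x: "x \<in> convex hull set vs \<and> a k \<bullet> x = b k"
    have "x \<in> convex hull {y \<in> set vs. a k \<bullet> y = b k}"
      using x 1 k by (intro convex_hull_supporting_hyperplane) (auto simp: in_set_conv_nth)
    moreover have "{y \<in> set vs. a k \<bullet> y = b k} \<subseteq> {vs ! k, nxt vs k}"
      using 2 k by (auto simp: in_set_conv_nth nxt_def)
    ultimately show "x \<in> closed_segment (vs ! k) (nxt vs k)"
      unfolding segment_convex_hull using hull_mono by blast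
  qed
qed

lemma convex_hull_edge: "e \<in> poly_edges F \<Longrightarrow> convex hull e \<subseteq> poly_boundary F"
  by (auto simp: poly_edges_def poly_boundary_def segment_convex_hull)

lemma vertices_subset_boundary: "set F \<subseteq> poly_boundary F"
  by (auto simp: poly_boundary_def in_set_conv_nth)

lemma edge_subset_vertices: "e \<in> poly_edges F \<Longrightarrow> e \<subseteq> set F"
  by (auto simp: poly_edges_def nxt_def dest: gr_implies_not0 intro!: nth_mem mod_less_divisor)

text \<open>In the plane minus the boundary, the points satisfying all inequalities strictly and
  those violating one lie in two disjoint open sets. So a component that starts inside stays in the
  bounded hull, while an outer point can escape along a ray.\<close>

lemma poly_region_convex:
  assumes "convex_polygon vs"
  shows "poly_region vs = convex hull (set vs)"
proof -
  define n B A where "n = length vs" and "B = poly_boundary vs" and "A = affine hull set vs"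
  obtain a b where ab: "edge_halfplanes vs a b"
    using assms(1) by (auto simp: convex_polygon_def)
  have
    1: "\<And>k x. k < n \<Longrightarrow> x \<in> convex hull set vs \<Longrightarrow> b k \<le> a k \<bullet> x" and
    2: "\<And>k j. k < n \<Longrightarrow> j < n \<Longrightarrow> a k \<bullet> vs ! j = b k \<longleftrightarrow> j = k \<or> j = Suc k mod n" and
    3: "\<And>x. x \<in> A \<Longrightarrow> (\<And>k. k < n \<Longrightarrow> b k \<le> a k \<bullet> x) \<Longrightarrow> x \<in> convex hull set vs" and
    4: "\<And>k x. k < n \<Longrightarrow>
       x \<in> closed_segment (vs ! k) (nxt vs k) \<longleftrightarrow> x \<in> convex hull set vs \<and> a k \<bullet> x = b k"
    unfolding n_def A_def by (fact edge_halfplanes_D[OF assms(1) ab])+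
  have B: "x \<in> B \<longleftrightarrow> x \<in> convex hull set vs \<and> (\<exists>k<n. a k \<bullet> x = b k)" for x
    using 4 by (auto simp: B_def poly_boundary_def n_def)
  have HA: "convex hull set vs \<subseteq> A" by (simp add: A_def convex_hull_subset_affine_hull)
  have bdd: "bounded (convex hull set vs)" by (simp add: bounded_convex_hull finite_imp_bounded)
  define U where "U = {x. \<forall>k<n. b k < a k \<bullet> x}"
  define W where "W = {x. \<exists>k<n. a k \<bullet> x < b k}"
  have "U = (\<Inter>k<n. {x. b k < a k \<bullet> x})" "W = (\<Union>k<n. {x. a k \<bullet> x < b k})"
    by (auto simp: U_def W_def)
  hence UW: "open U" "open W" by (auto intro!: open_halfspace_gt open_halfspace_lt open_INT)
  have cover: "A - B \<subseteq> U \<union> W"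
  proof
    fix x assume x: "x \<in> A - B"
    show "x \<in> U \<union> W"
    proof (rule ccontr)
      assume *: "x \<notin> U \<union> W"
      hence ge: "b k \<le> a k \<bullet> x" if "k < n" for k using that by (intro leI) (auto simp: W_def)
      hence "x \<in> convex hull set vs" using x by (intro 3) auto
      moreover obtain k where "k < n" "\<not> b k < a k \<bullet> x" using * by (auto simp: U_def)
      ultimately show False using x B[of x] ge[of k] by force
    qed
  qed
  have UH: "x \<in> convex hull set vs" if "x \<in> A" "x \<in> U" for x
    using that by (intro 3) (auto simp: U_def less_imp_le)
  have in1: "bounded (connected_component_set (A - B) x)" if x: "x \<in> convex hull set vs" "x \<notin> B" for x
  proof -
    let ?K = "connected_component_set (A - B) x"
    have xin: "x \<in> A - B" using x HA by auto
    have "x \<in> U" using cover xin 1[OF _ x(1)] by (force simp: W_def)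
    have "U \<inter> W \<inter> ?K = {}" by (force simp: U_def W_def)
    moreover have "?K \<subseteq> U \<union> W" using cover connected_component_subset[of "A - B" x] by blast
    moreover have "U \<inter> ?K \<noteq> {}" using \<open>x \<in> U\<close> xin by (auto simp: connected_component_refl)
    ultimately have "W \<inter> ?K = {}"
      using connectedD[OF connected_connected_component UW] by blast
    hence "?K \<subseteq> convex hull set vs"
      using \<open>?K \<subseteq> U \<union> W\<close> UH connected_component_subset[of "A - B" x] by blast
    thus ?thesis using bdd bounded_subset by blast
  qed
  have in2: "x \<in> convex hull set vs" if x: "x \<in> A - B" and bd: "bounded (connected_component_set (A - B) x)" for x
  proof (rule ccontr)
    assume "x \<notin> convex hull set vs"
    then obtain k where k: "k < n" "a k \<bullet> x < b k" using 3 x by (meson DiffD1 not_less)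
    \<comment> \<open>The ray from vertex \<open>k\<close> through \<open>x\<close>: the functional
      equals \<open>b k\<close> at the vertex and is smaller at \<open>x\<close>, so it stays below
      \<open>b k\<close> beyond \<open>x\<close> and the ray does not come back to the
      boundary.\<close>
    define d where "d = x - vs ! k"
    have v: "a k \<bullet> vs ! k = b k" using 2 k by auto
    have vA: "vs ! k \<in> A" using k by (auto simp: A_def n_def intro: hull_inc)
    let ?R = "(\<lambda>s. x + s *\<^sub>R d) ` {0..}"
    have lt: "a k \<bullet> (x + s *\<^sub>R d) < b k" if "0 \<le> s" for s
    proof -
      have "a k \<bullet> (x + s *\<^sub>R d) = a k \<bullet> x - s * (b k - a k \<bullet> x)"
        by (simp add: d_def inner_simps v algebra_simps)
      thus ?thesis using k that by (simp add: algebra_simps) (smt (verit) mult_left_mono)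
    qed
    have RA: "x + s *\<^sub>R d \<in> A" for s
    proof -
      have "(1 + s) *\<^sub>R x + (- s) *\<^sub>R (vs ! k) \<in> A"
        using x vA by (intro mem_affine) (auto simp: A_def)
      thus ?thesis by (simp add: d_def algebra_simps)
    qed
    have "?R \<subseteq> A - B"
      using lt RA 1[OF k(1)] by (force simp: B)
    moreover have "connected ?R"
      by (intro connected_continuous_image continuous_intros) (simp add: convex_connected)
    moreover have "x \<in> ?R" by (force intro: image_eqI[of _ _ 0])
    ultimately have "?R \<subseteq> connected_component_set (A - B) x"
      by (intro connected_component_maximal)
    hence "bounded ?R" using bd bounded_subset by blast
    then obtain M where M: "\<forall>y\<in>?R. norm y \<le> M" by (auto simp: bounded_iff)
    have "d \<noteq> 0" using k v by (auto simp: d_def)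
    define s where "s = (\<bar>M\<bar> + norm x + 1) / norm d"
    have s: "0 \<le> s" by (simp add: s_def)
    hence "norm (x + s *\<^sub>R d) \<le> M" using M by auto
    moreover have "norm (s *\<^sub>R d) = \<bar>M\<bar> + norm x + 1"
      using s \<open>d \<noteq> 0\<close> by (simp add: s_def)
    moreover have "norm (s *\<^sub>R d) \<le> norm (x + s *\<^sub>R d) + norm x"
      by (metis add.commute add_diff_cancel_left' norm_triangle_ineq4)
    ultimately show False by simp
  qed
  have "B \<subseteq> convex hull set vs" using B by auto
  thus ?thesis unfolding poly_region_def Let_def B_def[symmetric] A_def[symmetric]
    using in1 in2 HA by blast
qed

lemma poly_edge_cases:
  assumes "{v, w} \<in> poly_edges vs"
  obtains k where "k < length vs" "vs ! k = v \<and> nxt vs k = w \<or> vs ! k = w \<and> nxt vs k = v"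
  using assms unfolding poly_edges_def doubleton_eq_iff by (smt (verit) mem_Collect_eq doubleton_eq_iff)

text \<open>Everything rests on a side functional being tight at just two vertices. A strictly
  positive combination of \<open>v\<close>, \<open>w\<close>, \<open>w'\<close> on some side would
  make the functional of that side tight at all three, so the open triangle at the corner lies off
  the boundary.\<close>

lemma convex_polygon_corner:
  assumes "convex_polygon vs" "{v, w} \<in> poly_edges vs" "{v, w'} \<in> poly_edges vs" "w \<noteq> w'"
  shows "v \<noteq> w" "v \<noteq> w'" "\<not> collinear {v, w, w'}"
    and "0 < s \<Longrightarrow> 0 < r \<Longrightarrow> s + r < 1 \<Longrightarrow>
      v + s *\<^sub>R (w - v) + r *\<^sub>R (w' - v) \<in> convex hull set vs - poly_boundary vs"
proof -
  have n: "distinct vs" "3 \<le> length vs" using assms by (auto simp: convex_polygon_def)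
  obtain a b where ab: "edge_halfplanes vs a b"
    using assms(1) by (auto simp: convex_polygon_def)
  have
    1: "\<And>k x. k < length vs \<Longrightarrow> x \<in> convex hull set vs \<Longrightarrow> b k \<le> a k \<bullet> x" and
    2: "\<And>k j. k < length vs \<Longrightarrow> j < length vs \<Longrightarrow> a k \<bullet> vs ! j = b k \<longleftrightarrow> j = k \<or> j = Suc k mod length vs" and
    3: "\<And>x. x \<in> affine hull set vs \<Longrightarrow> (\<And>k. k < length vs \<Longrightarrow> b k \<le> a k \<bullet> x) \<Longrightarrow> x \<in> convex hull set vs" and
    4: "\<And>k x. k < length vs \<Longrightarrow>
       x \<in> closed_segment (vs ! k) (nxt vs k) \<longleftrightarrow> x \<in> convex hull set vs \<and> a k \<bullet> x = b k"
    by (fact edge_halfplanes_D[OF assms(1) ab])+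
  have in_vs: "v \<in> set vs" "w \<in> set vs" "w' \<in> set vs"
    using assms edge_subset_vertices by blast+
  obtain k where k: "k < length vs" "vs ! k = v \<and> nxt vs k = w \<or> vs ! k = w \<and> nxt vs k = v"
    using assms(2) by (rule poly_edge_cases)
  obtain k' where k': "k' < length vs" "vs ! k' = v \<and> nxt vs k' = w' \<or> vs ! k' = w' \<and> nxt vs k' = v"
    using assms(3) by (rule poly_edge_cases)
  show vw: "v \<noteq> w" and vw': "v \<noteq> w'"
    using k k' nxt_neq[OF n] by metis+
  have on: "x = vs ! j \<or> x = nxt vs j" if "j < length vs" "x \<in> set vs" "a j \<bullet> x = b j" for j x
    using that 2[OF that(1)] by (auto simp: in_set_conv_nth nxt_def)
  show "\<not> collinear {v, w, w'}"
  proof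
    assume "collinear {v, w, w'}"
    hence "collinear {w, v, w'}" by (simp add: insert_commute)
    then obtain c where c: "w' - v = c *\<^sub>R (w - v)"
      using vw by (auto simp: collinear_3 collinear_lemma)
    have "a k \<bullet> v = b k" "a k \<bullet> w = b k"
      using 4[OF k(1), of v] 4[OF k(1), of w] k(2) by auto
    moreover have "a k \<bullet> w' = a k \<bullet> v + c * (a k \<bullet> w - a k \<bullet> v)"
      using c by (metis add.commute diff_add_cancel inner_add_right inner_diff_right inner_scaleR_right)
    ultimately have "a k \<bullet> w' = b k" by simp
    thus False using on[OF k(1) in_vs(3)] k(2) vw' assms(4) by auto
  qed
  assume sr: "0 < s" "0 < r" "s + r < 1"
  let ?x = "v + s *\<^sub>R (w - v) + r *\<^sub>R (w' - v)"
  have x: "?x = (1 - s - r) *\<^sub>R v + s *\<^sub>R w + r *\<^sub>R w'" by (simp add: algebra_simps)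
  have "?x \<in> convex hull {v, w, w'}" unfolding convex_hull_3 x
    using sr by (intro CollectI exI[of _ "1 - s - r"] exI[of _ s] exI[of _ r]) auto
  hence "?x \<in> convex hull set vs"
    using in_vs hull_mono[of "{v, w, w'}" "set vs" convex] by auto
  moreover have "?x \<notin> poly_boundary vs"
  proof
    assume "?x \<in> poly_boundary vs"
    then obtain j where j: "j < length vs" "?x \<in> closed_segment (vs ! j) (nxt vs j)"
      by (auto simp: poly_boundary_def)
    hence "a j \<bullet> ?x = b j" using 4 by auto
    hence "(1 - s - r) * (a j \<bullet> v - b j) + s * (a j \<bullet> w - b j) + r * (a j \<bullet> w' - b j) = 0"
      unfolding x by (simp add: inner_simps algebra_simps)
    moreover have "0 \<le> a j \<bullet> v - b j" "0 \<le> a j \<bullet> w - b j" "0 \<le> a j \<bullet> w' - b j"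
      using 1[OF j(1)] in_vs by (auto intro: hull_inc)
    ultimately have "a j \<bullet> v = b j \<and> a j \<bullet> w = b j \<and> a j \<bullet> w' = b j"
      using sr by (smt (verit) mult_nonneg_nonneg mult_pos_pos)
    thus False using on[OF j(1)] in_vs vw vw' assms(4) by metis
  qed
  ultimately show "?x \<in> convex hull set vs - poly_boundary vs" by blast
qed

section \<open>Planar layouts of fans\<close>

text \<open>\<open>D\<close> contains a right isosceles triangle. Once the image of one leg is
  normalised, the distances to the three vertices determine every image point; the sign of
  \<open>Im J\<close> decides between rotation and reflection for all of \<open>D\<close> at
  once.\<close>

lemma complex_isometry_form:
  fixes g :: "complex \<Rightarrow> complex"
  assumes iso: "\<And>x y. x \<in> D \<Longrightarrow> y \<in> D \<Longrightarrow> dist (g x) (g y) = dist x y"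
    and D: "a \<in> D" "a + of_real h \<in> D" "a + \<i> * of_real h \<in> D" and h: "h > 0"
  shows "\<exists>p w. cmod w = 1 \<and> ((\<forall>z\<in>D. g z = p + w * z) \<or> (\<forall>z\<in>D. g z = p + w * cnj z))"
proof -
  define w where "w = (g (a + of_real h) - g a) / of_real h"
  have w: "cmod w = 1"
    using iso[OF D(2,1)] h by (simp add: w_def norm_divide dist_norm)
  hence w0: "w \<noteq> 0" by auto
  define G where "G z = (g z - g a) / w" for z
  have G: "cmod (G x - G y) = cmod (x - y)" if "x \<in> D" "y \<in> D" for x y
  proof -
    have "G x - G y = (g x - g y) / w" by (simp add: G_def diff_divide_distrib)
    thus ?thesis using iso[OF that] w by (simp add: norm_divide dist_norm)
  qed
  have Ga: "G a = 0" by (simp add: G_def)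
  have Gh: "G (a + of_real h) = of_real h" using w0 h by (simp add: G_def w_def)
  define J where "J = G (a + \<i> * of_real h)"
  have sq: "(Re (x - y))\<^sup>2 + (Im (x - y))\<^sup>2 = (Re (x' - y'))\<^sup>2 + (Im (x' - y'))\<^sup>2"
    if "cmod (x - y) = cmod (x' - y')" for x y x' y'
    using that by (simp add: cmod_def)
  have J1: "(Re J)\<^sup>2 + (Im J)\<^sup>2 = h\<^sup>2"
    using sq[OF G[OF D(3,1)]] by (simp add: J_def Ga)
  have J2: "(Re J - h)\<^sup>2 + (Im J)\<^sup>2 = h\<^sup>2 + h\<^sup>2"
    using sq[OF G[OF D(3,2)]] by (simp add: J_def Gh)
  have "2 * h * Re J = 0" using J1 J2 by (simp add: power2_eq_square algebra_simps)
  hence ReJ: "Re J = 0" using h by simp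
  hence "(Im J)\<^sup>2 = h\<^sup>2" using J1 by simp
  hence ImJ: "Im J = h \<or> Im J = - h" by (simp add: power2_eq_iff)
  have re: "Re (G z) = Re (z - a)" and im: "Im (G z) * Im J = Im (z - a) * h" if z: "z \<in> D" for z
  proof -
    have 1: "(Re (G z))\<^sup>2 + (Im (G z))\<^sup>2 = (Re (z - a))\<^sup>2 + (Im (z - a))\<^sup>2"
      using sq[OF G[OF z D(1)]] by (simp add: Ga)
    have 2: "(Re (G z) - h)\<^sup>2 + (Im (G z))\<^sup>2 = (Re (z - a) - h)\<^sup>2 + (Im (z - a))\<^sup>2"
      using sq[OF G[OF z D(2)]] by (simp add: Gh algebra_simps)
    have 3: "(Re (G z))\<^sup>2 + (Im (G z) - Im J)\<^sup>2 = (Re (z - a))\<^sup>2 + (Im (z - a) - h)\<^sup>2"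
      using sq[OF G[OF z D(3)]] ReJ by (simp add: J_def algebra_simps)
    have "2 * h * (Re (G z) - Re (z - a)) = 0"
      using 1 2 by (simp add: power2_eq_square algebra_simps)
    thus "Re (G z) = Re (z - a)" using h by simp
    have "(Im J)\<^sup>2 = h\<^sup>2" by fact
    hence "2 * (Im (G z) * Im J - Im (z - a) * h) = 0"
      using 1 3 by (simp add: power2_eq_square algebra_simps)
    thus "Im (G z) * Im J = Im (z - a) * h" by simp
  qed
  have g: "g z = g a + w * G z" for z using w0 by (simp add: G_def)
  from ImJ show ?thesis
  proof
    assume "Im J = h"
    hence *: "G z = z - a" if "z \<in> D" for z
      using re[OF that] im[OF that] h by (simp add: complex_eq_iff)
    have "g z = (g a - w * a) + w * z" if "z \<in> D" for z
      unfolding g[of z] *[OF that] by (simp add: algebra_simps)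
    thus ?thesis using w by blast
  next
    assume "Im J = - h"
    hence "h * (Im (G z) + Im (z - a)) = 0" if "z \<in> D" for z
      using im[OF that] by (simp add: algebra_simps)
    hence *: "G z = cnj (z - a)" if "z \<in> D" for z
      using re[OF that] that h by (fastforce simp: complex_eq_iff)
    have "g z = (g a - w * cnj a) + w * cnj z" if "z \<in> D" for z
      unfolding g[of z] *[OF that] by (simp add: algebra_simps)
    thus ?thesis using w by blast
  qed
qed

section \<open>Isometries of a corner in polar coordinates\<close>

lemma not_collinear_diff:
  fixes v w w' :: "'a::real_inner"
  assumes "\<not> collinear {v, w, w'}"
  shows "\<not> collinear {0, w - v, w' - v}"
  using assms collinear_3[of w v w'] by (simp add: insert_commute)

lemma vangle_props:
  fixes x y :: "'a::real_inner"
  assumes "\<not> collinear {0, x, y}"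
  shows "0 < vangle x y" "vangle x y < pi" "x \<bullet> y = norm x * norm y * cos (vangle x y)"
proof -
  have nz: "x \<noteq> 0" "y \<noteq> 0" using assms by (auto simp: insert_commute)
  hence pos: "0 < norm x * norm y" by simp
  have "\<bar>x \<bullet> y\<bar> \<noteq> norm x * norm y" using assms norm_cauchy_schwarz_equal by blast
  hence "\<bar>x \<bullet> y\<bar> < norm x * norm y"
    using Cauchy_Schwarz_ineq2[of x y] by linarith
  hence "\<bar>x \<bullet> y / (norm x * norm y)\<bar> < 1" using pos by (simp add: abs_div)
  hence b: "-1 < x \<bullet> y / (norm x * norm y)" "x \<bullet> y / (norm x * norm y) < 1" by linarith+
  show "0 < vangle x y" "vangle x y < pi" "x \<bullet> y = norm x * norm y * cos (vangle x y)"
    unfolding vangle_def using arccos_lt_bounded[OF b] b pos by (simp_all add: cos_arccos)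
qed

text \<open>The corner at \<open>v\<close> of the triangle \<open>v w w'\<close>. The flags \<open>L\<close> and \<open>R\<close> tell whether the sides
  towards \<open>w\<close> and \<open>w'\<close> are included; the apex \<open>v\<close> never is, because it may be cut.\<close>

definition corner :: "'a::real_vector \<Rightarrow> 'a \<Rightarrow> 'a \<Rightarrow> bool \<Rightarrow> bool \<Rightarrow> 'a set" where
  "corner v w w' L R = {v + s *\<^sub>R (w - v) + r *\<^sub>R (w' - v) | s r.
     0 \<le> s \<and> 0 \<le> r \<and> 0 < s + r \<and> s + r < 1 \<and> (L \<or> 0 < r) \<and> (R \<or> 0 < s)}"

text \<open>For connectedness: a corner free of cuts then lies in a single component of its face
  minus the cuts, where an unfolding preserves distances.\<close>

lemma convex_corner: "convex (corner v w w' L R)"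
proof (rule convexI)
  fix x y and u u' :: real
  assume "x \<in> corner v w w' L R" "y \<in> corner v w w' L R" and u: "0 \<le> u" "0 \<le> u'" "u + u' = 1"
  then obtain s r s' r' where
    x: "x = v + s *\<^sub>R (w - v) + r *\<^sub>R (w' - v)" "0 \<le> s" "0 \<le> r" "0 < s + r" "s + r < 1" "L \<or> 0 < r" "R \<or> 0 < s" and
    y: "y = v + s' *\<^sub>R (w - v) + r' *\<^sub>R (w' - v)" "0 \<le> s'" "0 \<le> r'" "0 < s' + r'" "s' + r' < 1" "L \<or> 0 < r'" "R \<or> 0 < s'"
    unfolding corner_def by blast
  have pos: "0 < u * A + u' * B" if "0 < A" "0 < B" for A B
    using that u by (cases "u = 0") (auto intro: add_pos_nonneg)
  have "u *\<^sub>R x + u' *\<^sub>R y = (u + u') *\<^sub>R v + (u * s + u' * s') *\<^sub>R (w - v) + (u * r + u' * r') *\<^sub>R (w' - v)"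
    unfolding x(1) y(1) by (simp add: algebra_simps)
  moreover have "0 \<le> u * s + u' * s'" "0 \<le> u * r + u' * r'" using x y u by auto
  moreover have "0 < u * s + u' * s' + (u * r + u' * r')"
    using pos[OF x(4) y(4)] by (simp add: algebra_simps)
  moreover have "u * s + u' * s' + (u * r + u' * r') < 1"
    using pos[of "1 - (s + r)" "1 - (s' + r')"] x(5) y(5) u by (simp add: algebra_simps)
  moreover have "L \<or> 0 < u * r + u' * r'" "R \<or> 0 < u * s + u' * s'" using x y pos by blast+
  ultimately show "u *\<^sub>R x + u' *\<^sub>R y \<in> corner v w w' L R"
    unfolding corner_def u(3) by auto
qed

text \<open>Polar coordinates at the apex: \<open>d \<tau>\<close> is the direction at angle \<tau>
  from the first side, \<sigma> the orientation chosen by \<open>g\<close>, and \<rho> a radius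
  below which the sector lies in the corner. The point \<open>p\<close> stands in for the image of
  \<open>v\<close>, which is not in the corner. Giving \<open>d 0\<close> and
  \<open>d \<theta>\<close> by \<open>sgn\<close> lets neighbouring corners be compared along their
  common side.\<close>

lemma corner_isometry_form:
  fixes v w w' :: "'a::real_inner" and g :: "'a \<Rightarrow> complex"
  defines "\<theta> \<equiv> vangle (w - v) (w' - v)"
  assumes nc: "\<not> collinear {v, w, w'}"
    and iso: "\<And>x y. x \<in> corner v w w' L R \<Longrightarrow> y \<in> corner v w w' L R \<Longrightarrow> dist (g x) (g y) = dist x y"
  shows "\<exists>d p z \<sigma> \<rho>. 0 < \<rho> \<and> z \<noteq> 0 \<and> (\<sigma> = 1 \<or> \<sigma> = -1) \<and> d 0 = sgn (w - v) \<and> d \<theta> = sgn (w' - v) \<and>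
    (\<forall>r \<tau>. 0 < r \<and> r < \<rho> \<and> 0 < \<tau> \<and> \<tau> < \<theta> \<longrightarrow> v + r *\<^sub>R d \<tau> \<in> corner v w w' False False) \<and>
    (\<forall>r \<tau>. 0 < r \<and> r < \<rho> \<and> (0 < \<tau> \<or> L \<and> \<tau> = 0) \<and> (\<tau> < \<theta> \<or> R \<and> \<tau> = \<theta>) \<longrightarrow>
        g (v + r *\<^sub>R d \<tau>) = p + of_real r * z * cis (\<sigma> * \<tau>))"
proof -
  note \<theta> = vangle_props[OF not_collinear_diff[OF nc], folded \<theta>_def]
  define l l' where "l = norm (w - v)" and "l' = norm (w' - v)"
  have l: "0 < l" "0 < l'" using nc by (auto simp: l_def l'_def insert_commute)
  have sin: "0 < sin \<theta>" using \<theta> by (simp add: sin_gt_zero)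
  \<comment> \<open>Gram-Schmidt on the two sides: \<open>e\<close> and \<open>e'\<close> form an
    orthonormal frame of the plane of the corner.\<close>
  define e where "e = sgn (w - v)"
  define e' where "e' = (1 / sin \<theta>) *\<^sub>R (sgn (w' - v) - cos \<theta> *\<^sub>R e)"
  have w: "w - v = l *\<^sub>R e" using l by (simp add: e_def l_def sgn_div_norm)
  have sgn': "sgn (w' - v) = cos \<theta> *\<^sub>R e + sin \<theta> *\<^sub>R e'" using sin by (simp add: e'_def)
  have w': "w' - v = l' *\<^sub>R (cos \<theta> *\<^sub>R e + sin \<theta> *\<^sub>R e')"
    unfolding sgn'[symmetric] using l by (simp add: l'_def sgn_div_norm)
  have ee: "e \<bullet> e = 1" using l by (simp add: e_def l_def norm_eq_1[symmetric] norm_sgn)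
  have ss: "sgn (w' - v) \<bullet> sgn (w' - v) = 1" using l by (simp add: l'_def norm_eq_1[symmetric] norm_sgn)
  have es: "e \<bullet> sgn (w' - v) = cos \<theta>"
  proof -
    have "e \<bullet> sgn (w' - v) = ((w - v) \<bullet> (w' - v)) / (l * l')"
      by (simp add: e_def sgn_div_norm l_def l'_def divide_inverse mult_ac)
    thus ?thesis using \<theta>(3) l by (simp add: l_def l'_def)
  qed
  have ee': "e \<bullet> e' = 0" by (simp add: e'_def inner_simps ee es)
  have "e' \<bullet> e' = (1 - (cos \<theta>)\<^sup>2) / (sin \<theta>)\<^sup>2"
    using es by (simp add: e'_def inner_simps ee ss inner_commute power2_eq_square)
  hence e'e': "e' \<bullet> e' = 1" using sin by (simp add: sin_squared_eq[symmetric])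
  define E where "E z = v + Re z *\<^sub>R e + Im z *\<^sub>R e'" for z
  have distE: "dist (E x) (E y) = dist x y" for x y
  proof -
    have "E x - E y = Re (x - y) *\<^sub>R e + Im (x - y) *\<^sub>R e'" by (simp add: E_def algebra_simps)
    moreover have "(norm (s *\<^sub>R e + r *\<^sub>R e'))\<^sup>2 = s\<^sup>2 + r\<^sup>2" for s r
      unfolding power2_norm_eq_inner
      using ee' by (simp add: inner_simps ee e'e' inner_commute[of e' e] power2_eq_square)
    ultimately have "(norm (E x - E y))\<^sup>2 = (Re (x - y))\<^sup>2 + (Im (x - y))\<^sup>2" by simp
    thus ?thesis unfolding dist_norm cmod_def by (rule real_sqrt_unique[symmetric]) simp
  qed
  \<comment> \<open>Oblique coordinates along \<open>w - v\<close> and \<open>w' - v\<close> of the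
    point with Cartesian coordinates \<open>z\<close>; they decide membership in the corner.\<close>
  define A where "A z = (Re z * sin \<theta> - Im z * cos \<theta>) / (l * sin \<theta>)" for z
  define B where "B z = Im z / (l' * sin \<theta>)" for z
  have EAB: "E z = v + A z *\<^sub>R (w - v) + B z *\<^sub>R (w' - v)" for z
  proof -
    have "A z * l + B z * l' * cos \<theta> = Re z" "B z * l' * sin \<theta> = Im z"
      using l sin by (simp_all add: A_def B_def field_simps)
    moreover have "v + A z *\<^sub>R (w - v) + B z *\<^sub>R (w' - v) =
       v + (A z * l + B z * l' * cos \<theta>) *\<^sub>R e + (B z * l' * sin \<theta>) *\<^sub>R e'"
      unfolding w w' by (simp add: algebra_simps)
    ultimately show ?thesis by (simp add: E_def)
  qed
  define D where "D = {z. E z \<in> corner v w w' L R}"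
  have inD: "z \<in> D" if "0 \<le> A z" "0 \<le> B z" "0 < A z + B z" "A z + B z < 1" "L \<or> 0 < B z" "R \<or> 0 < A z" for z
    using that unfolding D_def corner_def mem_Collect_eq EAB by blast
  define U where "U = {z. 0 < A z \<and> 0 < B z \<and> A z + B z < 1}"
  have UD: "U \<subseteq> D" by (auto simp: U_def intro!: inD add_pos_pos)
  have "open U" unfolding U_def A_def B_def
    by (intro open_Collect_conj open_Collect_less continuous_intros) (use l sin in auto)
  \<comment> \<open>The point with oblique coordinates (1/4, 1/4); a ball around it has room for the
    right triangle that \<open>complex_isometry_form\<close> asks for.\<close>
  moreover define z0 where "z0 = Complex (l / 4 + l' / 4 * cos \<theta>) (l' / 4 * sin \<theta>)"
  have "A z0 = 1 / 4" "B z0 = 1 / 4" using l sin by (simp_all add: A_def B_def z0_def field_simps)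
  hence "z0 \<in> U" by (simp add: U_def)
  ultimately obtain \<epsilon> where \<epsilon>: "0 < \<epsilon>" "ball z0 \<epsilon> \<subseteq> U" using open_contains_ball by blast
  have mem: "z0 \<in> D" "z0 + of_real (\<epsilon> / 2) \<in> D" "z0 + \<i> * of_real (\<epsilon> / 2) \<in> D"
    using \<epsilon> UD by (auto simp: dist_norm norm_mult intro!: subsetD[OF UD] subsetD[OF \<epsilon>(2)])
  have iso': "dist (g (E x)) (g (E y)) = dist x y" if "x \<in> D" "y \<in> D" for x y
    using iso[of "E x" "E y"] that distE by (simp add: D_def)
  obtain p z where z: "cmod z = 1" and
    *: "(\<forall>x\<in>D. g (E x) = p + z * x) \<or> (\<forall>x\<in>D. g (E x) = p + z * cnj x)"
    using complex_isometry_form[of D "\<lambda>x. g (E x)", OF iso' mem] \<epsilon> by auto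
  obtain \<sigma> :: real where \<sigma>: "\<sigma> = 1 \<or> \<sigma> = -1" and
    g: "\<And>r \<tau>. of_real r * cis \<tau> \<in> D \<Longrightarrow> g (E (of_real r * cis \<tau>)) = p + of_real r * z * cis (\<sigma> * \<tau>)"
    using *
  proof
    assume "\<forall>x\<in>D. g (E x) = p + z * x"
    thus thesis by (intro that[of 1]) (auto simp: mult_ac)
  next
    assume "\<forall>x\<in>D. g (E x) = p + z * cnj x"
    thus thesis by (intro that[of "-1"]) (auto simp: mult_ac cis_cnj)
  qed
  define d where "d \<tau> = cos \<tau> *\<^sub>R e + sin \<tau> *\<^sub>R e'" for \<tau>
  have Ed: "E (of_real r * cis \<tau>) = v + r *\<^sub>R d \<tau>" for r \<tau>
    by (simp add: E_def d_def algebra_simps)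
  \<comment> \<open>Bounding both sines by 1 gives A + B \<le> r / \<rho>, so below this radius the
    far side of the triangle is not reached.\<close>
  define \<rho> where "\<rho> = sin \<theta> / (1 / l + 1 / l')"
  have \<rho>: "0 < \<rho>" using l sin by (simp add: \<rho>_def add_pos_pos)
  have A: "A (of_real r * cis \<tau>) = r * sin (\<theta> - \<tau>) / (l * sin \<theta>)"
    and B: "B (of_real r * cis \<tau>) = r * sin \<tau> / (l' * sin \<theta>)" for r \<tau>
    by (simp_all add: A_def B_def sin_diff algebra_simps)
  have lt1: "A (of_real r * cis \<tau>) + B (of_real r * cis \<tau>) < 1" if "0 < r" "r < \<rho>" for r \<tau>
  proof -
    have "r * sin (\<theta> - \<tau>) / (l * sin \<theta>) \<le> r * 1 / (l * sin \<theta>)"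
      "r * sin \<tau> / (l' * sin \<theta>) \<le> r * 1 / (l' * sin \<theta>)"
      using that l sin by (auto intro!: divide_right_mono mult_left_mono)
    moreover have "r * 1 / (l * sin \<theta>) + r * 1 / (l' * sin \<theta>) = r / \<rho>"
      using l sin by (simp add: \<rho>_def field_simps)
    moreover have "r / \<rho> < 1" using that \<rho> by simp
    ultimately show ?thesis unfolding A B by linarith
  qed
  have Apos: "0 < A (of_real r * cis \<tau>)" if "0 < r" "0 \<le> \<tau>" "\<tau> < \<theta>" for r \<tau>
    unfolding A using that l sin \<theta> by (intro divide_pos_pos mult_pos_pos sin_gt_zero) auto
  have Bpos: "0 < B (of_real r * cis \<tau>)" if "0 < r" "0 < \<tau>" "\<tau> \<le> \<theta>" for r \<tau>
    unfolding B using that l sin \<theta> by (intro divide_pos_pos mult_pos_pos sin_gt_zero) auto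
  have B0: "B (of_real r * cis 0) = 0" and A0: "A (of_real r * cis \<theta>) = 0" for r
    unfolding A B by simp_all
  have F1: "v + r *\<^sub>R d \<tau> \<in> corner v w w' False False" if "0 < r" "r < \<rho>" "0 < \<tau>" "\<tau> < \<theta>" for r \<tau>
    using Apos[of r \<tau>] Bpos[of r \<tau>] lt1[of r \<tau>] that unfolding Ed[symmetric] EAB corner_def
    by (intro CollectI exI[of _ "A (of_real r * cis \<tau>)"] exI[of _ "B (of_real r * cis \<tau>)"]) auto
  have F2: "g (v + r *\<^sub>R d \<tau>) = p + of_real r * z * cis (\<sigma> * \<tau>)"
    if r: "0 < r" "r < \<rho>" and \<tau>: "0 < \<tau> \<or> L \<and> \<tau> = 0" "\<tau> < \<theta> \<or> R \<and> \<tau> = \<theta>" for r \<tau>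
  proof -
    have "of_real r * cis \<tau> \<in> D"
    proof (rule inD)
      show "A (of_real r * cis \<tau>) + B (of_real r * cis \<tau>) < 1" using lt1 r by blast
      show "0 \<le> A (of_real r * cis \<tau>)" "R \<or> 0 < A (of_real r * cis \<tau>)"
        using \<tau> \<theta>(1) Apos[OF r(1), of \<tau>] A0[of r] by (fastforce intro: less_imp_le)+
      show "0 \<le> B (of_real r * cis \<tau>)" "L \<or> 0 < B (of_real r * cis \<tau>)"
        using \<tau> \<theta>(1) Bpos[OF r(1), of \<tau>] B0[of r] by (fastforce intro: less_imp_le)+
      show "0 < A (of_real r * cis \<tau>) + B (of_real r * cis \<tau>)"
        using \<tau> \<theta>(1) Bpos[OF r(1), of \<tau>] B0[of r] Apos[OF r(1), of \<tau>] A0[of r]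
        by (smt (verit))
    qed
    thus ?thesis using g Ed by metis
  qed
  have "d 0 = sgn (w - v)" "d \<theta> = sgn (w' - v)" by (simp_all add: d_def e_def sgn')
  moreover have "z \<noteq> 0" using z by auto
  ultimately show ?thesis using \<rho> \<sigma> F1 F2
    by (intro exI[of _ d] exI[of _ p] exI[of _ z] exI[of _ \<sigma>] exI[of _ \<rho>] conjI) auto
qed

text \<open>Consecutive corners agree on their common side, so they have a common image of the apex;
  injectivity forces all of them to have the same orientation, hence they wind around this point.\<close>

lemma fan_angle_sum_le:
  fixes v :: "'a::real_inner" and w :: "nat \<Rightarrow> 'a" and g :: "'a \<Rightarrow> complex"
  defines "\<theta> \<equiv> \<lambda>j. vangle (w j - v) (w (Suc j) - v)"
  assumes nc: "\<And>j. j < k \<Longrightarrow> \<not> collinear {v, w j, w (Suc j)}"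
    and iso: "\<And>j x y. j < k \<Longrightarrow> x \<in> corner v (w j) (w (Suc j)) (0 < j) (Suc j < k) \<Longrightarrow>
        y \<in> corner v (w j) (w (Suc j)) (0 < j) (Suc j < k) \<Longrightarrow> dist (g x) (g y) = dist x y"
    and inj: "\<And>i j x y. i < j \<Longrightarrow> j < k \<Longrightarrow> x \<in> corner v (w i) (w (Suc i)) False False \<Longrightarrow>
        y \<in> corner v (w j) (w (Suc j)) False False \<Longrightarrow> g x \<noteq> g y"
  shows "(\<Sum>j<k. \<theta> j) \<le> 2 * pi"
proof (rule ccontr)
  assume "\<not> (\<Sum>j<k. \<theta> j) \<le> 2 * pi"
  hence big: "2 * pi < (\<Sum>j<k. \<theta> j)" by simp
  have \<theta>: "0 < \<theta> j" "\<theta> j < pi" if "j < k" for j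
    unfolding \<theta>_def using not_collinear_diff[OF nc[OF that]] by (rule vangle_props)+
  have "\<forall>j. \<exists>d p z \<sigma> \<rho>. j < k \<longrightarrow>
    0 < \<rho> \<and> z \<noteq> 0 \<and> (\<sigma> = 1 \<or> \<sigma> = -1) \<and> d 0 = sgn (w j - v) \<and> d (\<theta> j) = sgn (w (Suc j) - v) \<and>
    (\<forall>r \<tau>. 0 < r \<and> r < \<rho> \<and> 0 < \<tau> \<and> \<tau> < \<theta> j \<longrightarrow> v + r *\<^sub>R d \<tau> \<in> corner v (w j) (w (Suc j)) False False) \<and>
    (\<forall>r \<tau>. 0 < r \<and> r < \<rho> \<and> (0 < \<tau> \<or> 0 < j \<and> \<tau> = 0) \<and> (\<tau> < \<theta> j \<or> Suc j < k \<and> \<tau> = \<theta> j) \<longrightarrow>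
        g (v + r *\<^sub>R d \<tau>) = p + of_real r * z * cis (\<sigma> * \<tau>))"
    (is "\<forall>j. \<exists>d p z \<sigma> \<rho>. j < k \<longrightarrow> ?Q j d p z \<sigma> \<rho>")
  proof
    fix j
    show "\<exists>d p z \<sigma> \<rho>. j < k \<longrightarrow> ?Q j d p z \<sigma> \<rho>"
    proof (cases "j < k")
      case True
      have "\<exists>d p z \<sigma> \<rho>. ?Q j d p z \<sigma> \<rho>"
        unfolding \<theta>_def by (rule corner_isometry_form[OF nc[OF True]]) (rule iso[OF True])
      thus ?thesis using True by simp
    qed simp
  qed
  then obtain d p z \<sigma> \<rho> where "\<forall>j. j < k \<longrightarrow> ?Q j (d j) (p j) (z j) (\<sigma> j) (\<rho> j)"
    unfolding choice_iff by (elim exE) (rule that)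
  hence Q: "?Q j (d j) (p j) (z j) (\<sigma> j) (\<rho> j)" if "j < k" for j using that by blast
  have k0: "0 < k" using big by (cases k) (auto simp: not_less)
  define R where "R = Min (\<rho> ` {..<k})"
  have R: "R \<le> \<rho> j" if "j < k" for j unfolding R_def using that by simp
  have R0: "0 < R" unfolding R_def using Q k0 by (subst Min_gr_iff) auto
  define r where "r = R / 2"
  have val: "g (v + s *\<^sub>R d j \<tau>) = p j + of_real s * z j * cis (\<sigma> j * \<tau>)"
    if "j < k" "0 < s" "s < R" "0 < \<tau> \<or> 0 < j \<and> \<tau> = 0" "\<tau> < \<theta> j \<or> Suc j < k \<and> \<tau> = \<theta> j" for j s \<tau>
  proof -
    have "s < \<rho> j" using that R[OF that(1)] by linarith
    thus ?thesis using Q[OF that(1)] that(2-) by blast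
  qed
  have int: "v + s *\<^sub>R d j \<tau> \<in> corner v (w j) (w (Suc j)) False False"
    if "j < k" "0 < s" "s < R" "0 < \<tau>" "\<tau> < \<theta> j" for j s \<tau>
  proof -
    have "s < \<rho> j" using that R[OF that(1)] by linarith
    thus ?thesis using Q[OF that(1)] that(2-) by blast
  qed
  have glue: "p (Suc j) = p j" "z (Suc j) = z j * cis (\<sigma> j * \<theta> j)" if j: "Suc j < k" for j
  proof -
    have eq: "p (Suc j) + of_real s * z (Suc j) = p j + of_real s * (z j * cis (\<sigma> j * \<theta> j))"
      if s: "0 < s" "s < R" for s
    proof -
      have "d j (\<theta> j) = d (Suc j) 0" using Q[of j] Q[of "Suc j"] j by simp
      moreover have "g (v + s *\<^sub>R d j (\<theta> j)) = p j + of_real s * z j * cis (\<sigma> j * \<theta> j)"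
        using j s \<theta> by (intro val) auto
      moreover have "g (v + s *\<^sub>R d (Suc j) 0) = p (Suc j) + of_real s * z (Suc j) * cis (\<sigma> (Suc j) * 0)"
        using j s \<theta> by (intro val) auto
      ultimately show ?thesis by (simp add: mult.assoc)
    qed
    \<comment> \<open>The identity \<open>eq\<close> is affine in \<open>s\<close>, so two radii
      suffice to separate its constant from its slope.\<close>
    define a b where "a = z (Suc j)" and "b = z j * cis (\<sigma> j * \<theta> j)"
    have 1: "p (Suc j) + of_real (R/2) * a = p j + of_real (R/2) * b" unfolding a_def b_def
      using eq[of "R/2"] R0 by simp
    have 2: "p (Suc j) + of_real (R/4) * a = p j + of_real (R/4) * b" unfolding a_def b_def
      using eq[of "R/4"] R0 by simp
    have "complex_of_real (R/2) = 2 * of_real (R/4)" by simp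
    with 1 2 have "of_real (R/4) * (a - b) = 0" by algebra
    hence "a = b" using R0 by simp
    thus "p (Suc j) = p j" "z (Suc j) = z j * cis (\<sigma> j * \<theta> j)" using 1 by (simp_all add: a_def b_def)
  qed
  have same_sign: "\<sigma> (Suc j) = \<sigma> j" if j: "Suc j < k" for j
  proof (rule ccontr)
    assume "\<sigma> (Suc j) \<noteq> \<sigma> j" \<comment> \<open>then corner \<open>Suc j\<close> is folded back onto corner \<open>j\<close>\<close>
    hence neg: "\<sigma> (Suc j) = - \<sigma> j" using Q[of j] Q[of "Suc j"] j by auto
    \<comment> \<open>Small enough to fit into both corners; the two points at this angle from the
      common side get the same image.\<close>
    define \<tau> where "\<tau> = min (\<theta> j) (\<theta> (Suc j)) / 2"
    have \<tau>: "0 < \<tau>" "\<tau> < \<theta> j" "\<tau> < \<theta> (Suc j)"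
      using \<theta>[of j] \<theta>[of "Suc j"] j by (auto simp: \<tau>_def)
    have "g (v + r *\<^sub>R d j (\<theta> j - \<tau>)) = p j + of_real r * z j * cis (\<sigma> j * (\<theta> j - \<tau>))"
      using j \<tau> R0 by (intro val) (auto simp: r_def)
    also have "\<dots> = p (Suc j) + of_real r * z (Suc j) * cis (\<sigma> (Suc j) * \<tau>)"
      using j by (simp add: glue neg cis_mult mult.assoc right_diff_distrib)
    also have "\<dots> = g (v + r *\<^sub>R d (Suc j) \<tau>)"
      using j \<tau> R0 by (intro val[symmetric]) (auto simp: r_def)
    finally show False
      using inj[of j "Suc j"] int[of j r "\<theta> j - \<tau>"] int[of "Suc j" r \<tau>] j \<tau> R0 by (auto simp: r_def)
  qed
  define S where "S j = (\<Sum>i<j. \<theta> i)" for j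
  have all: "p j = p 0 \<and> \<sigma> j = \<sigma> 0 \<and> z j = z 0 * cis (\<sigma> 0 * S j)" if "j < k" for j
    using that
  proof (induction j)
    case (Suc j)
    thus ?case using glue[of j] same_sign[of j]
      by (simp add: S_def cis_mult mult.assoc distrib_left)
  qed (simp add: S_def)
  \<comment> \<open>The least number of corners whose angles exceed a full turn; the last of them,
    corner \<open>j\<close>, runs over the initial direction again.\<close>
  define n where "n = (LEAST n. 2 * pi < S n)"
  have Sk: "2 * pi < S k" using big by (simp add: S_def)
  have Sn: "2 * pi < S n" unfolding n_def using Sk by (rule LeastI)
  have nk: "n \<le> k" unfolding n_def using Sk by (rule Least_le)
  have "n \<noteq> 0" using Sn by (intro notI) (simp add: S_def not_less)
  then obtain j where j: "n = Suc j" by (cases n) auto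
  have Sj: "S j \<le> 2 * pi" using not_less_Least[of j "\<lambda>n. 2 * pi < S n"] j by (simp add: n_def)
  have jk: "j < k" using nk j by simp
  have SS: "S (Suc j) = S j + \<theta> j" by (simp add: S_def)
  have "j \<noteq> 0" using Sn j SS \<theta>[of 0] k0 pi_gt_zero by (intro notI) (simp add: S_def)
  \<comment> \<open>Small enough for direction \<epsilon> to lie in corner 0 and direction 2\<pi> +
    \<epsilon> in corner \<open>j\<close>. Their images coincide, against injectivity.\<close>
  define \<epsilon> where "\<epsilon> = min (\<theta> 0) (S n - 2 * pi) / 2"
  have \<epsilon>: "0 < \<epsilon>" "\<epsilon> < \<theta> 0" "\<epsilon> < S n - 2 * pi" using \<theta>[OF k0] Sn by (auto simp: \<epsilon>_def)
  define \<tau> where "\<tau> = 2 * pi + \<epsilon> - S j"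
  have \<tau>: "0 < \<tau>" "\<tau> < \<theta> j" using Sj \<epsilon> SS j by (auto simp: \<tau>_def)
  have per: "cis (\<sigma> 0 * (2 * pi)) = 1"
    using Q[OF k0] by (auto simp: cis.code complex_eq_iff)
  have "g (v + r *\<^sub>R d j \<tau>) = p j + of_real r * z j * cis (\<sigma> j * \<tau>)"
    using jk \<tau> R0 by (intro val) (auto simp: r_def)
  also have "\<dots> = p 0 + of_real r * z 0 * cis (\<sigma> 0 * S j + \<sigma> 0 * \<tau>)"
    using all[OF jk] by (simp add: cis_mult mult.assoc)
  also have "\<sigma> 0 * S j + \<sigma> 0 * \<tau> = \<sigma> 0 * (2 * pi) + \<sigma> 0 * \<epsilon>" by (simp add: \<tau>_def algebra_simps)
  also have "cis \<dots> = cis (\<sigma> 0 * \<epsilon>)" by (simp add: per cis_mult[symmetric])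
  also have "p 0 + of_real r * z 0 * \<dots> = g (v + r *\<^sub>R d 0 \<epsilon>)"
    using k0 \<epsilon> R0 by (intro val[symmetric]) (auto simp: r_def)
  finally show False
    using inj[of 0 j "v + r *\<^sub>R d 0 \<epsilon>" "v + r *\<^sub>R d j \<tau>"] int[of 0 r \<epsilon>] int[of j r \<tau>] jk \<open>j \<noteq> 0\<close> \<epsilon> \<tau> R0 k0 by (auto simp: r_def)
qed

section \<open>Cuts of polyhedra with convex faces\<close>

text \<open>The definition tests whether the bisector enters the region. For 0 < s < 1/(1/l + 1/l')
  the point on it has positive coefficients s/l and s/l' with sum below 1, hence lies in the open
  corner, and the angle is the one below \<pi>.\<close>

lemma convex_polygon_interior_angle:
  assumes "convex_polygon vs" "i < length vs"
  shows "interior_angle vs i < pi"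
proof -
  define n where "n = length vs"
  have n: "3 \<le> n" "distinct vs" using assms by (auto simp: convex_polygon_def n_def)
  have i: "i < n" using assms by (simp add: n_def)
  define j where "j = (i + n - 1) mod n"
  have j: "j < n" using n by (simp add: j_def)
  have "Suc j mod n = (i + n - 1 + 1) mod n" unfolding j_def by (simp add: mod_Suc_eq)
  hence sj: "Suc j mod n = i" using i n by simp
  let ?v = "vs ! i" and ?w = "prv vs i" and ?w' = "nxt vs i"
  have w: "?w = vs ! j" by (simp add: prv_def j_def n_def)
  have si: "Suc i mod n < n" using n by simp
  have "j \<noteq> Suc i mod n"
  proof
    assume "j = Suc i mod n"
    hence *: "Suc (Suc i mod n) mod n = i" using sj by simp
    hence "Suc (Suc i) mod n = i" by (simp add: mod_Suc_eq)
    thus False using n(1) i by (cases "Suc (Suc i) < n") (auto simp: mod_if split: if_splits)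
  qed
  hence ww': "?w \<noteq> ?w'" unfolding w nxt_def using n j si by (simp add: nth_eq_iff_index_eq n_def)
  have e': "{?v, ?w'} \<in> poly_edges vs" using assms by (auto simp: poly_edges_def)
  have "nxt vs j = ?v" using sj by (simp add: nxt_def n_def)
  hence e: "{?v, ?w} \<in> poly_edges vs"
    unfolding w using j by (auto simp: poly_edges_def n_def insert_commute intro!: exI[of _ j])
  note c = convex_polygon_corner[OF assms(1) e e' ww']
  note a = vangle_props(2)[OF not_collinear_diff[OF c(3)]]
  define l l' where "l = norm (?w - ?v)" and "l' = norm (?w' - ?v)"
  have l: "0 < l" "0 < l'" using c by (auto simp: l_def l'_def)
  have "?v + s *\<^sub>R ((1 / l) *\<^sub>R (?w - ?v) + (1 / l') *\<^sub>R (?w' - ?v)) \<in> poly_region vs"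
    if s: "0 < s" "s < 1 / (1 / l + 1 / l')" for s
  proof -
    have "s * (1 / l + 1 / l') < 1" using s l by (subst (asm) pos_less_divide_eq) (auto intro: add_pos_pos)
    hence "?v + (s / l) *\<^sub>R (?w - ?v) + (s / l') *\<^sub>R (?w' - ?v) \<in> convex hull set vs - poly_boundary vs"
      using s l by (intro c(4)) (auto simp: distrib_left)
    thus ?thesis using poly_region_convex[OF assms(1)] by (simp add: scaleR_add_right add.assoc)
  qed
  moreover have "0 < 1 / (1 / l + 1 / l')" using l by (auto intro: add_pos_pos)
  ultimately have "\<exists>e>0. \<forall>s. 0 < s \<and> s < e \<longrightarrow>
      ?v + s *\<^sub>R ((1 / l) *\<^sub>R (?w - ?v) + (1 / l') *\<^sub>R (?w' - ?v)) \<in> poly_region vs" by blast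
  thus ?thesis using a unfolding interior_angle_def Let_def l_def l'_def by simp
qed

section \<open>Position of cut edges relative to faces\<close>

lemma simple_polygon_edges_Int:
  assumes "simple_polygon vs" "e \<in> poly_edges vs" "e' \<in> poly_edges vs" "e \<noteq> e'"
    "x \<in> convex hull e" "x \<in> convex hull e'"
  shows "x \<in> e \<and> x \<in> e'"
proof -
  obtain i j where i: "i < length vs" "e = {vs ! i, nxt vs i}" and j: "j < length vs" "e' = {vs ! j, nxt vs j}"
    using assms(2,3) by (auto simp: poly_edges_def)
  have "i \<noteq> j" using assms(4) i j by auto
  hence "closed_segment (vs ! i) (nxt vs i) \<inter> closed_segment (vs ! j) (nxt vs j) =
          (if j = Suc i mod length vs then {vs ! j}
           else if i = Suc j mod length vs then {vs ! i} else {})"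
    using assms(1) i(1) j(1) unfolding simple_polygon_def by blast
  moreover have "x \<in> closed_segment (vs ! i) (nxt vs i) \<inter> closed_segment (vs ! j) (nxt vs j)"
    using assms(5,6) by (simp add: i j segment_convex_hull)
  ultimately show ?thesis unfolding i j nxt_def by (auto split: if_splits)
qed

lemma polyhedron_faces_Int:
  assumes "is_polyhedron P" "F \<in> P" "G \<in> P" "F \<noteq> G" "x \<in> poly_region F" "x \<in> poly_region G"
  shows "x \<in> set F \<inter> set G \<or> (\<exists>e \<in> poly_edges F \<inter> poly_edges G. x \<in> convex hull e)"
proof -
  obtain V E where "V \<subseteq> set F \<inter> set G" "E \<subseteq> poly_edges F \<inter> poly_edges G"
      "poly_region F \<inter> poly_region G = V \<union> \<Union> ((\<lambda>e. convex hull e) ` E)"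
    using assms unfolding is_polyhedron_def by meson
  thus ?thesis using assms(5,6) by blast
qed

lemma boundary_subset_region: "poly_boundary F \<subseteq> poly_region F"
  by (simp add: poly_region_def Let_def)

text \<open>A point common to two faces lies at a shared vertex or on a shared side. If that side is
  not \<open>e\<close>, two sides of one simple polygon meet there, which happens only at vertices.
  So cuts along edges never run through a face.\<close>

lemma edge_Int_face:
  assumes P: "is_polyhedron P" and "e \<in> polyhedron_edges P" "F \<in> P" "x \<in> poly_region F" "x \<in> convex hull e"
  shows "x \<in> set F \<or> e \<in> poly_edges F"
proof -
  obtain G where G: "G \<in> P" "e \<in> poly_edges G" using assms by (auto simp: polyhedron_edges_def)
  show ?thesis
  proof (cases "G = F")
    case False
    have "x \<in> poly_region G" using G assms convex_hull_edge boundary_subset_region by blast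
    with polyhedron_faces_Int[OF P assms(3) G(1)] False assms
    consider "x \<in> set F" | e' where "e' \<in> poly_edges F" "e' \<in> poly_edges G" "x \<in> convex hull e'" by blast
    thus ?thesis
    proof cases
      case 2
      have "simple_polygon G" using P G by (simp add: is_polyhedron_def)
      thus ?thesis using simple_polygon_edges_Int[of G e e' x] 2 G assms edge_subset_vertices by blast
    qed simp
  qed (use G in simp)
qed

lemma vertex_on_edge:
  assumes "simple_polygon F" "e \<in> poly_edges F" "x \<in> set F" "x \<in> convex hull e"
  shows "x \<in> e"
proof -
  obtain i where i: "i < length F" "x = F ! i" using assms by (auto simp: in_set_conv_nth)
  let ?e = "{F ! i, nxt F i}"
  have "?e \<in> poly_edges F" using i by (auto simp: poly_edges_def)
  moreover have "x \<in> convex hull ?e" using i by (auto intro: hull_inc)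
  ultimately show ?thesis
    using simple_polygon_edges_Int[of F e ?e x] assms i by (cases "e = ?e") auto
qed

text \<open>Cuts can touch an uncut edge only at its endpoints, so two faces stay joined along its
  relative interior.\<close>

lemma open_edge_disjoint_cut:
  assumes P: "is_polyhedron P" and E: "E \<subseteq> polyhedron_edges P" and F: "F \<in> P"
    and e: "{v, w} \<in> poly_edges F" "{v, w} \<notin> E" and x: "x \<in> convex hull {v, w}" "x \<noteq> v" "x \<noteq> w"
  shows "x \<notin> (\<Union>e\<in>E. convex hull e)"
proof
  assume "x \<in> (\<Union>e\<in>E. convex hull e)"
  then obtain e' where e': "e' \<in> E" "x \<in> convex hull e'" by blast
  have xF: "x \<in> poly_region F" using x e convex_hull_edge boundary_subset_region by blast
  have "simple_polygon F" using P F by (simp add: is_polyhedron_def)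
  from edge_Int_face[OF P _ F xF e'(2)] e' E have "x \<in> set F \<or> e' \<in> poly_edges F" by blast
  thus False
    using vertex_on_edge[OF \<open>simple_polygon F\<close> e(1) _ x(1)] x
      simple_polygon_edges_Int[OF \<open>simple_polygon F\<close> e(1) _ _ x(1) e'(2)] e' e by fastforce
qed

lemma face_interior_disjoint_cut:
  assumes P: "is_polyhedron P" and E: "E \<subseteq> polyhedron_edges P" and F: "F \<in> P"
    and x: "x \<in> poly_region F - poly_boundary F"
  shows "x \<notin> (\<Union>e\<in>E. convex hull e)"
proof
  assume "x \<in> (\<Union>e\<in>E. convex hull e)"
  then obtain e where e: "e \<in> E" "x \<in> convex hull e" by blast
  hence "x \<in> set F \<or> e \<in> poly_edges F" using edge_Int_face[OF P _ F _ e(2)] x E by auto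
  thus False using x e(2) convex_hull_edge[of e F] vertices_subset_boundary[of F] by auto
qed

section \<open>Angle sums and connectedness after cutting\<close>

lemma unfolding_isometric_on_convex:
  assumes "unfolding_map P C f" "F \<in> P" "convex S" "S \<subseteq> poly_region F - C" "x \<in> S" "y \<in> S"
  shows "dist (f x) (f y) = dist x y"
proof -
  have "poly_region F - C \<noteq> {}" "connected S" using assms convex_connected by auto
  then obtain K where "K \<in> components (poly_region F - C)" "S \<subseteq> K"
    using exists_component_superset[OF assms(4)] by blast
  thus ?thesis using assms unfolding unfolding_map_def by blast
qed

text \<open>Complex numbers turn rotations about the apex into multiplications by
  \<open>cis\<close>.\<close>

definition plane_to_complex :: "real^2 \<Rightarrow> complex" where
  "plane_to_complex x = Complex (x $ 1) (x $ 2)"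

lemma dist_plane_to_complex: "dist (plane_to_complex x) (plane_to_complex y) = dist x y"
  by (simp add: plane_to_complex_def dist_norm cmod_def norm_vec_def L2_set_def sum_2)

text \<open>The faces must be distinct, but \<open>w 0 = w k\<close> is allowed: a full turn around
  \<open>v\<close> may start and end at the same edge, even a cut one. Only the edges strictly
  inside the fan have to be uncut.\<close>

lemma unfolding_fan_angle_sum_le:
  fixes w :: "nat \<Rightarrow> real^3" and F :: "nat \<Rightarrow> (real^3) list"
  assumes P: "is_polyhedron P" and conv: "\<And>F. F \<in> P \<Longrightarrow> convex_polygon F"
    and E: "E \<subseteq> polyhedron_edges P" and C: "C = (\<Union>e\<in>E. convex hull e)"
    and f: "unfolding_map P C f"
    and F: "\<And>j. j < k \<Longrightarrow> F j \<in> P" "inj_on F {..<k}"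
    and e: "\<And>j. j < k \<Longrightarrow> {v, w j} \<in> poly_edges (F j)" "\<And>j. j < k \<Longrightarrow> {v, w (Suc j)} \<in> poly_edges (F j)"
      "\<And>j. j < k \<Longrightarrow> w j \<noteq> w (Suc j)"
    and uncut: "\<And>j. 0 < j \<Longrightarrow> j < k \<Longrightarrow> {v, w j} \<notin> E"
  shows "(\<Sum>j<k. vangle (w j - v) (w (Suc j) - v)) \<le> 2 * pi"
proof -
  note c = convex_polygon_corner[OF conv[OF F(1)] e]
  have region: "poly_region (F j) = convex hull set (F j)" if "j < k" for j
    using poly_region_convex conv F that by blast
  have int: "x \<in> poly_region (F j) - poly_boundary (F j)"
    if "j < k" "x \<in> corner v (w j) (w (Suc j)) False False" for j x
    using that c(4) by (auto simp: corner_def region)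
  have edge: "v + s *\<^sub>R (u - v) \<in> poly_region (F j) - C"
    if "j < k" "{v, u} \<in> poly_edges (F j)" "{v, u} \<notin> E" "0 < s" "s < 1" "v \<noteq> u" for j s u
  proof -
    have *: "v + s *\<^sub>R (u - v) = (1 - s) *\<^sub>R v + s *\<^sub>R u" by (simp add: algebra_simps)
    have x: "v + s *\<^sub>R (u - v) \<in> convex hull {v, u}"
      unfolding segment_convex_hull[symmetric] closed_segment_def * using that by force
    have "(1 - s) *\<^sub>R (u - v) \<noteq> 0" using that by auto
    moreover have "u - (v + s *\<^sub>R (u - v)) = (1 - s) *\<^sub>R (u - v)" by (simp add: algebra_simps)
    ultimately have "v + s *\<^sub>R (u - v) \<noteq> u" by force
    moreover have "v + s *\<^sub>R (u - v) \<noteq> v" using that by simp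
    ultimately show ?thesis
      using x open_edge_disjoint_cut[OF P E F(1)[OF that(1)] that(2,3) x] C
        convex_hull_edge[OF that(2)] boundary_subset_region by blast
  qed
  \<comment> \<open>The flags include exactly the sides shared with a neighbour in the fan, and
    these are assumed to be uncut.\<close>
  have sub: "corner v (w j) (w (Suc j)) (0 < j) (Suc j < k) \<subseteq> poly_region (F j) - C" if j: "j < k" for j
  proof
    fix x assume "x \<in> corner v (w j) (w (Suc j)) (0 < j) (Suc j < k)"
    then obtain s r where x: "x = v + s *\<^sub>R (w j - v) + r *\<^sub>R (w (Suc j) - v)"
      "0 \<le> s" "0 \<le> r" "0 < s + r" "s + r < 1" "0 < j \<or> 0 < r" "Suc j < k \<or> 0 < s"
      unfolding corner_def by blast
    consider "0 < s" "0 < r" | "s = 0" "0 < r" | "r = 0" "0 < s" using x by fastforce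
    thus "x \<in> poly_region (F j) - C"
    proof cases
      case 1
      hence "x \<in> corner v (w j) (w (Suc j)) False False" using x unfolding corner_def by blast
      thus ?thesis using int[OF j] face_interior_disjoint_cut[OF P E F(1)[OF j]] C by blast
    next
      case 2
      thus ?thesis using edge[OF j e(2)[OF j] uncut, of r] x c(2)[OF j j j j] by auto
    next
      case 3
      thus ?thesis using edge[OF j e(1)[OF j] uncut, of s] x c(1)[OF j j j j] j by auto
    qed
  qed
  show ?thesis
  proof (rule fan_angle_sum_le[where g = "\<lambda>x. plane_to_complex (f x)"])
    show "\<not> collinear {v, w j, w (Suc j)}" if "j < k" for j using c(3) that by blast
    show "dist (plane_to_complex (f x)) (plane_to_complex (f y)) = dist x y"
      if "j < k" "x \<in> corner v (w j) (w (Suc j)) (0 < j) (Suc j < k)"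
        "y \<in> corner v (w j) (w (Suc j)) (0 < j) (Suc j < k)" for j x y
      using unfolding_isometric_on_convex[OF f F(1)[OF that(1)] convex_corner sub[OF that(1)] that(2,3)]
      by (simp add: dist_plane_to_complex)
    show "plane_to_complex (f x) \<noteq> plane_to_complex (f y)"
      if ij: "i < j" "j < k" and x: "x \<in> corner v (w i) (w (Suc i)) False False"
        and y: "y \<in> corner v (w j) (w (Suc j)) False False" for i j x y
    proof -
      have i: "i < k" using ij by simp
      have x': "x \<in> poly_region (F i) - poly_boundary (F i)" "x \<notin> C"
        using int[OF i x] face_interior_disjoint_cut[OF P E F(1)[OF i]] C by blast+
      have y': "y \<in> poly_region (F j) - poly_boundary (F j)" "y \<notin> C"
        using int[OF ij(2) y] face_interior_disjoint_cut[OF P E F(1)[OF ij(2)]] C by blast+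
      \<comment> \<open>Different faces meet only in vertices and sides, so points off their
        boundaries are different.\<close>
      have "F i \<noteq> F j" using F(2) ij by (auto simp: inj_on_def)
      hence "x \<noteq> y"
        using polyhedron_faces_Int[OF P F(1)[OF i] F(1)[OF ij(2)], of x] x' y'
          vertices_subset_boundary[of "F i"] convex_hull_edge[of _ "F i"] by blast
      moreover have "inj_on f (surface P - C)" using f by (simp add: unfolding_map_def)
      moreover have "x \<in> surface P - C" "y \<in> surface P - C"
        using x' y' F(1)[OF i] F(1)[OF ij(2)] by (auto simp: surface_def)
      ultimately have "f x \<noteq> f y" by (meson inj_onD)
      thus ?thesis using dist_plane_to_complex[of "f x" "f y"] by auto
    qed
  qed
qed

text \<open>Both groups of faces have closed unions, and whatever they share lies in
  \<open>C\<close>, so away from \<open>C\<close> they are disjoint. Neither becomes empty, because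
  cuts along edges spare the interior of a face.\<close>

lemma separating_cut:
  assumes P: "is_polyhedron P" and conv: "\<And>F. F \<in> P \<Longrightarrow> convex_polygon F"
    and E: "E \<subseteq> polyhedron_edges P" and C: "C = (\<Union>e\<in>E. convex hull e)"
    and Q: "Q \<subseteq> P" "Q \<noteq> {}" "P - Q \<noteq> {}"
    and v: "\<And>F G v. F \<in> Q \<Longrightarrow> G \<in> P - Q \<Longrightarrow> v \<in> set F \<Longrightarrow> v \<in> set G \<Longrightarrow> v \<in> \<Union>E"
    and e: "\<And>F G e. F \<in> Q \<Longrightarrow> G \<in> P - Q \<Longrightarrow> e \<in> poly_edges F \<Longrightarrow> e \<in> poly_edges G \<Longrightarrow> e \<in> E"
  shows "\<not> connected (surface P - C)"
proof
  assume con: "connected (surface P - C)"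
  have fin: "finite P" using P by (simp add: is_polyhedron_def)
  let ?A = "\<Union>F\<in>Q. poly_region F" and ?B = "\<Union>F\<in>P - Q. poly_region F"
  have cl: "closed (poly_region F)" if "F \<in> P" for F
    using poly_region_convex[OF conv[OF that]]
    by (simp add: compact_imp_closed compact_convex_hull finite_imp_compact)
  have AB: "closed ?A" "closed ?B"
    using cl Q fin by (auto intro!: closed_UN finite_subset[of Q P])
  have ne: "poly_region F - C \<noteq> {}" if "F \<in> P" for F
  proof -
    note cF = conv[OF that]
    have n: "3 \<le> length F" "distinct F" using cF by (auto simp: convex_polygon_def)
    let ?e1 = "{F ! 1, F ! 0}" and ?e2 = "{F ! 1, F ! 2}"
    have "?e1 \<in> poly_edges F" unfolding poly_edges_def nxt_def
      using n by (intro CollectI exI[of _ 0]) auto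
    moreover have "?e2 \<in> poly_edges F" unfolding poly_edges_def nxt_def
      using n by (intro CollectI exI[of _ 1]) (auto simp: numeral_2_eq_2)
    moreover have "F ! 0 \<noteq> F ! 2" using n by (subst nth_eq_iff_index_eq) auto
    \<comment> \<open>The centroid of three consecutive vertices serves as an interior
      point.\<close>
    ultimately have "F ! 1 + (1/3) *\<^sub>R (F ! 0 - F ! 1) + (1/3) *\<^sub>R (F ! 2 - F ! 1) \<in> convex hull set F - poly_boundary F"
      by (intro convex_polygon_corner(4)[OF cF]) auto
    thus ?thesis
      using face_interior_disjoint_cut[OF P E that] C poly_region_convex[OF cF] by blast
  qed
  have "?A \<inter> ?B \<inter> (surface P - C) = {}"
  proof (rule ccontr)
    assume "\<not> ?thesis"
    then obtain F G x where x: "F \<in> Q" "G \<in> P - Q" "x \<in> poly_region F" "x \<in> poly_region G" "x \<notin> C" by blast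
    have "x \<in> set F \<inter> set G \<or> (\<exists>e \<in> poly_edges F \<inter> poly_edges G. x \<in> convex hull e)"
      using polyhedron_faces_Int[OF P] x Q by blast
    hence "x \<in> \<Union>E \<or> (\<exists>e\<in>E. x \<in> convex hull e)" using v e x by blast
    thus False using x(5) C by (auto intro: hull_inc)
  qed
  moreover have "surface P - C \<subseteq> ?A \<union> ?B" by (auto simp: surface_def)
  moreover obtain F G where "F \<in> Q" "G \<in> P - Q" using Q by blast
  hence "?A \<inter> (surface P - C) \<noteq> {}" "?B \<inter> (surface P - C) \<noteq> {}"
    using ne[of F] ne[of G] Q by (auto simp: surface_def)
  ultimately show False
    using connected_closedD[OF con _ _ AB] by blast
qed

section \<open>Angles\<close>

lemma vangle_commute: "vangle x y = vangle y x"
  by (simp add: vangle_def inner_commute mult.commute)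

lemma vangle_scaleR:
  assumes "0 < k"
  shows "vangle x (k *\<^sub>R y) = vangle x y"
  using assms by (simp add: vangle_def)

lemma vangle_minus: "vangle (- x) y = pi - vangle x y"
proof -
  have "\<bar>x \<bullet> y / (norm x * norm y)\<bar> \<le> 1"
    using Cauchy_Schwarz_ineq2[of x y] by (auto simp: abs_div divide_simps)
  hence "- 1 \<le> x \<bullet> y / (norm x * norm y)" "x \<bullet> y / (norm x * norm y) \<le> 1" by linarith+
  thus ?thesis unfolding vangle_def by (simp add: arccos_minus)
qed

text \<open>With legs of length \<open>r\<close> the base has length 2 r sin(\<gamma>/2), so the
  cosine of a base angle is sin(\<gamma>/2).\<close>

lemma isosceles_base_angle:
  fixes x y z :: "'a::real_inner"
  assumes "\<not> collinear {z, x, y}" "dist z x = dist z y" "vangle (x - z) (y - z) = \<gamma>"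
  shows "vangle (y - x) (z - x) = pi / 2 - \<gamma> / 2"
proof -
  define p q r where "p = x - z" and "q = y - z" and "r = norm p"
  have q: "norm q = r" using assms(2) by (simp add: p_def q_def r_def dist_norm norm_minus_commute)
  have nc: "\<not> collinear {0, p, q}" using not_collinear_diff[OF assms(1)] by (simp add: p_def q_def)
  have \<gamma>: "0 < \<gamma>" "\<gamma> < pi" "p \<bullet> q = r * r * cos \<gamma>"
    using vangle_props[OF nc] assms(3) q by (simp_all add: p_def q_def r_def)
  have r: "0 < r" using nc by (auto simp: r_def)
  have s: "0 < sin (\<gamma> / 2)" using \<gamma> by (intro sin_gt_zero) auto
  have c: "cos \<gamma> = 1 - 2 * (sin (\<gamma> / 2))\<^sup>2" using cos_double_sin[of "\<gamma> / 2"] by simp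
  have pp: "p \<bullet> p = r * r" "q \<bullet> q = r * r"
    using q by (simp_all add: r_def dot_square_norm power2_eq_square)
  have "(norm (q - p))\<^sup>2 = (2 * r * sin (\<gamma> / 2))\<^sup>2"
    unfolding power2_norm_eq_inner
    by (simp add: inner_simps inner_commute[of q p] pp \<gamma>(3) c power2_eq_square algebra_simps)
  hence n: "norm (q - p) = 2 * r * sin (\<gamma> / 2)" using r s by (simp add: power2_eq_iff_nonneg)
  have i: "(q - p) \<bullet> (- p) = r * r * (2 * (sin (\<gamma> / 2))\<^sup>2)"
    by (simp add: inner_simps inner_commute[of q p] pp \<gamma>(3) c algebra_simps)
  have "(q - p) \<bullet> (- p) / (norm (q - p) * norm (- p)) = sin (\<gamma> / 2)"
    unfolding i n using r s by (simp add: r_def[symmetric] power2_eq_square)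
  moreover have "y - x = q - p" "z - x = - p" by (simp_all add: p_def q_def)
  ultimately have "vangle (y - x) (z - x) = arccos (sin (\<gamma> / 2))" by (simp only: vangle_def)
  also have "sin (\<gamma> / 2) = cos (pi / 2 - \<gamma> / 2)" by (simp add: cos_diff)
  also have "arccos \<dots> = pi / 2 - \<gamma> / 2" using \<gamma> by (intro arccos_cos) auto
  finally show ?thesis .
qed

text \<open>Projecting both legs to the base gives L = (|p| + |q|) cos \<beta>. With the law of
  cosines this becomes (|p|^2 - |q|^2) sin^2 \<beta> = 0, so the legs are equal.\<close>

lemma equal_base_angles_apex:
  fixes x y z :: "'a::real_inner"
  assumes nc: "\<not> collinear {x, y, z}" and \<beta>: "vangle (z - x) (y - x) = \<beta>" "vangle (z - y) (x - y) = \<beta>"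
  shows "vangle (x - z) (y - z) = pi - 2 * \<beta>"
proof -
  define b p q L where "b = y - x" and "p = z - x" and "q = z - y" and "L = norm b"
  have q: "q = p - b" by (simp add: b_def p_def q_def)
  have "\<not> collinear {0, z - x, y - x}" "\<not> collinear {0, z - y, x - y}"
    using nc not_collinear_diff[of x z y] not_collinear_diff[of y z x] by (simp_all add: insert_commute)
  note v = vangle_props[OF this(1), unfolded \<beta>] vangle_props[OF this(2), unfolded \<beta>]
  have pb: "p \<bullet> b = norm p * L * cos \<beta>" using v(3) by (simp add: p_def b_def L_def)
  have "q \<bullet> (- b) = norm q * L * cos \<beta>" using v(6) by (simp add: q_def b_def L_def norm_minus_commute)
  hence qb: "q \<bullet> b = - (norm q * L * cos \<beta>)" by simp
  have L: "0 < L" using nc by (auto simp: L_def b_def)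
  have bb: "b \<bullet> b = L * L" by (simp add: L_def dot_square_norm power2_eq_square)
  have "q \<bullet> b = p \<bullet> b - b \<bullet> b" by (simp add: q inner_diff_left)
  hence "L * (norm p * cos \<beta> + norm q * cos \<beta> - L) = 0" using pb qb bb by (simp add: algebra_simps)
  hence "norm p * cos \<beta> + norm q * cos \<beta> - L = 0" using L by simp
  hence len: "L = (norm p + norm q) * cos \<beta>" by (simp add: algebra_simps)
  have "q \<bullet> q = p \<bullet> p - 2 * (p \<bullet> b) + b \<bullet> b" by (simp add: q inner_simps inner_commute)
  hence "norm q * norm q = norm p * norm p - 2 * norm p * L * cos \<beta> + L * L"
    unfolding pb bb by (simp add: dot_square_norm power2_eq_square)
  also have "\<dots> = norm p * norm p - (norm p + norm q) * (norm p - norm q) * (cos \<beta>)\<^sup>2"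
    by (simp add: len power2_eq_square algebra_simps)
  finally have "(norm p + norm q) * (norm p - norm q) * (1 - (cos \<beta>)\<^sup>2) = 0"
    by (simp add: algebra_simps)
  moreover have "1 - (cos \<beta>)\<^sup>2 \<noteq> 0" using v(1,2) sin_gt_zero[of \<beta>] by (simp add: sin_squared_eq[symmetric])
  moreover have np: "0 < norm p" using nc by (auto simp: p_def insert_commute)
  ultimately have pq: "norm q = norm p" by (smt (verit) mult_eq_0_iff norm_ge_zero)
  have "p \<bullet> q = p \<bullet> p - p \<bullet> b" by (simp add: q inner_diff_right)
  also have "\<dots> = norm p * norm p * (1 - 2 * (cos \<beta>)\<^sup>2)"
    unfolding pb len pq by (simp add: dot_square_norm power2_eq_square algebra_simps)
  also have "1 - 2 * (cos \<beta>)\<^sup>2 = cos (pi - 2 * \<beta>)" by (simp add: cos_diff cos_double_cos)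
  finally have I: "p \<bullet> q / (norm p * norm q) = cos (pi - 2 * \<beta>)" using np pq by simp
  \<comment> \<open>Positivity gives \<beta> < \<pi>/2, which puts \<pi> - 2\<beta> into the range
    where \<open>arccos\<close> inverts the cosine.\<close>
  have "cos \<beta> > 0" using len L np pq by (simp add: zero_less_mult_iff)
  hence \<beta>': "\<beta> < pi / 2" using v(2) cos_monotone_0_pi_le[of "pi / 2" \<beta>] by force
  have "x - z = - p" "y - z = - q" by (simp_all add: p_def q_def)
  hence "vangle (x - z) (y - z) = arccos (cos (pi - 2 * \<beta>))" unfolding I[symmetric] by (simp add: vangle_def)
  also have "\<dots> = pi - 2 * \<beta>" using v(1) \<beta>' by (intro arccos_cos) auto
  finally show ?thesis .
qed

section \<open>Cuts of hats\<close>

text \<open>The angles at the middle vertex \<open>b\<close> in cyclic order, starting and ending at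
  the tip. They add up to 2\<pi> + 2\<alpha> - 2\<beta>.\<close>

definition basic_hat_angles :: "real^3 \<Rightarrow> real^3 \<Rightarrow> real^3 \<Rightarrow> real^3 \<Rightarrow> real^3 \<Rightarrow> real \<Rightarrow> real \<Rightarrow> bool" where
  "basic_hat_angles t a b c B \<alpha> \<beta> \<longleftrightarrow>
     vangle (t - b) (c - b) = \<alpha> \<and> vangle (c - b) (B - b) = pi - \<beta> \<and>
     vangle (B - b) (a - b) = pi - \<beta> \<and> vangle (a - b) (t - b) = \<alpha>"

text \<open>Here \<open>b\<close> is adjacent to two corners, \<open>A\<close> and \<open>B\<close>,
  with a brim triangle on a boundary edge between them. The sum is 2\<pi> + 2\<alpha> - 2\<beta> -
  \<gamma>.\<close>

definition tri_hat_angles :: "real^3 \<Rightarrow> real^3 \<Rightarrow> real^3 \<Rightarrow> real^3 \<Rightarrow> real^3 \<Rightarrow> real^3 \<Rightarrow> real \<Rightarrow> real \<Rightarrow> real \<Rightarrow> bool" where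
  "tri_hat_angles t a b c A B \<alpha> \<beta> \<gamma> \<longleftrightarrow>
     vangle (t - b) (c - b) = \<alpha> \<and> vangle (c - b) (B - b) = pi / 2 - \<gamma> / 2 \<and>
     vangle (B - b) (A - b) = pi - 2 * \<beta> \<and> vangle (A - b) (a - b) = pi / 2 - \<gamma> / 2 \<and>
     vangle (a - b) (t - b) = \<alpha>"

text \<open>Here \<open>a\<close>, \<open>b\<close>, \<open>c\<close> stand for the middle vertices; \<open>Mxy\<close> says that the edge from \<open>x\<close> to \<open>y\<close>
  is cut, \<open>Kx\<close> that some edge from \<open>x\<close> to a corner is cut, and \<open>Tx\<close> that the edge from \<open>x\<close> to
  the tip is cut.\<close>

lemma hat_cut_contradiction:
  assumes "Mab \<or> Ka" "Mca \<or> Ka" "Ka \<longrightarrow> Ta \<or> Mca \<or> Mab"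
    "Mbc \<or> Kb" "Mab \<or> Kb" "Kb \<longrightarrow> Tb \<or> Mab \<or> Mbc"
    "Mca \<or> Kc" "Mbc \<or> Kc" "Kc \<longrightarrow> Tc \<or> Mbc \<or> Mca"
    "\<not> (Mab \<and> Mbc \<and> Mca)"
    "\<not> (Ka \<and> Kb \<and> Mab)" "\<not> (Kb \<and> Kc \<and> Mbc)" "\<not> (Kc \<and> Ka \<and> Mca)"
    "\<not> (Ka \<and> Kb \<and> Mbc \<and> Mca)" "\<not> (Kb \<and> Kc \<and> Mca \<and> Mab)" "\<not> (Kc \<and> Ka \<and> Mab \<and> Mbc)"
    "\<not> (Ka \<and> Kb \<and> Ta \<and> Tb)"
  shows False
  \<comment> \<open>Count the cut spike base edges; an uncut one forces corner edges at both its
    ends. Three cut ones form a cycle. Two of them, with the corner edges at the ends of the uncut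
    one, form a chain from boundary to boundary. If only one is cut, all three vertices have corner
    edges, and those at its ends complete such a chain. If none is cut, every middle vertex needs
    its tip edge, and a chain passes through the tip.\<close>
  using assms by (cases Mab; cases Mbc; cases Mca; cases Ka; cases Kb; cases Kc; simp)

locale unfolded_polyhedron =
  fixes P :: "(real^3) list set" and E :: "(real^3) set set" and f :: "real^3 \<Rightarrow> real^2"
  assumes poly: "is_polyhedron P" and convex: "F \<in> P \<Longrightarrow> convex_polygon F"
    and cut_edges: "E \<subseteq> polyhedron_edges P"
    and connected: "connected (surface P - (\<Union>e\<in>E. convex hull e))"
    and unfold: "unfolding_map P (\<Union>e\<in>E. convex hull e) f"
begin

text \<open>The angle bound read backwards, for literal lists. The entries of \<open>ws\<close> at
  index 0 and at the last index are the outer edges of the fan, where no cut is claimed.\<close>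

lemma fan_cut:
  assumes "length ws = Suc (length Fs)" "set Fs \<subseteq> P" "distinct Fs"
    and "\<forall>j<length Fs. {v, ws ! j} \<in> poly_edges (Fs ! j) \<and> {v, ws ! Suc j} \<in> poly_edges (Fs ! j) \<and> ws ! j \<noteq> ws ! Suc j"
    and "2 * pi < (\<Sum>j<length Fs. vangle (ws ! j - v) (ws ! Suc j - v))"
  shows "\<exists>j<length Fs. 0 < j \<and> {v, ws ! j} \<in> E"
proof (rule ccontr)
  assume "\<not> ?thesis"
  hence "(\<Sum>j<length Fs. vangle (ws ! j - v) (ws ! Suc j - v)) \<le> 2 * pi"
    using assms(2-4)
    by (intro unfolding_fan_angle_sum_le[OF poly convex cut_edges refl unfold, where F = "(!) Fs"])
       (auto simp: inj_on_def nth_eq_iff_index_eq)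
  thus False using assms(5) by simp
qed

lemma no_separation:
  assumes "W \<subseteq> E" "P = Q \<union> R" "Q \<inter> R = {}" "Q \<noteq> {}" "R \<noteq> {}"
    "\<forall>F\<in>Q. \<forall>G\<in>R. set F \<inter> set G \<subseteq> \<Union>W \<and> poly_edges F \<inter> poly_edges G \<subseteq> W"
  shows False
proof -
  have "P - Q = R" using assms by auto
  hence "\<not> connected (surface P - (\<Union>e\<in>E. convex hull e))"
    using assms by (intro separating_cut[OF poly convex cut_edges refl, of Q]) blast+
  thus False using connected by simp
qed

text \<open>Each chain of cuts is closed or closes up along the boundary; the proof names the faces
  on its two sides. The rotated chains follow by relabelling the hat.\<close>

lemma basic_hat_cycles:
  assumes P: "P = {[t,a,b],[t,b,c],[t,c,a],[a,b,B,A],[b,c,C,B],[c,a,A,C]}"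
    and d: "distinct [t,a,b,c,A,B,C]"
  shows "\<not> ({a,b} \<in> E \<and> {b,c} \<in> E \<and> {c,a} \<in> E)"
    "\<not> ({a,A} \<in> E \<and> {b,B} \<in> E \<and> {a,b} \<in> E)"
    "\<not> ({a,A} \<in> E \<and> {b,B} \<in> E \<and> {b,c} \<in> E \<and> {c,a} \<in> E)"
    "\<not> ({a,A} \<in> E \<and> {b,B} \<in> E \<and> {t,a} \<in> E \<and> {t,b} \<in> E)"
proof -
  \<comment> \<open>The reversed list provides every inequality between vertices in the other
    direction as well, so that equations between doubletons can be decided.\<close>
  have d': "distinct [C,B,A,c,b,a,t]" using d by auto
  note s = doubleton_eq_iff poly_edges_simps Int_insert_left insert_commute
  show "\<not> ({a,b} \<in> E \<and> {b,c} \<in> E \<and> {c,a} \<in> E)"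
    by (rule notI, rule no_separation[of "{{a,b},{b,c},{c,a}}"
      "{[t,a,b],[t,b,c],[t,c,a]}" "{[a,b,B,A],[b,c,C,B],[c,a,A,C]}"])
      (use d d' in \<open>simp_all add: P s\<close>)
  show "\<not> ({a,A} \<in> E \<and> {b,B} \<in> E \<and> {a,b} \<in> E)"
    by (rule notI, rule no_separation[of "{{a,A},{b,B},{a,b}}"
      "{[a,b,B,A]}" "{[t,a,b],[t,b,c],[t,c,a],[b,c,C,B],[c,a,A,C]}"])
      (use d d' in \<open>simp_all add: P s\<close>)
  show "\<not> ({a,A} \<in> E \<and> {b,B} \<in> E \<and> {b,c} \<in> E \<and> {c,a} \<in> E)"
    by (rule notI, rule no_separation[of "{{a,A},{b,B},{b,c},{c,a}}"
      "{[b,c,C,B],[c,a,A,C]}" "{[t,a,b],[t,b,c],[t,c,a],[a,b,B,A]}"])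
      (use d d' in \<open>simp_all add: P s\<close>)
  show "\<not> ({a,A} \<in> E \<and> {b,B} \<in> E \<and> {t,a} \<in> E \<and> {t,b} \<in> E)"
    by (rule notI, rule no_separation[of "{{a,A},{b,B},{t,a},{t,b}}"
      "{[a,b,B,A],[t,a,b]}" "{[t,b,c],[t,c,a],[b,c,C,B],[c,a,A,C]}"])
      (use d d' in \<open>simp_all add: P s\<close>)
qed

text \<open>A middle vertex has edges to two corners, so apart from the first two claims each chain
  comes in four versions: \<open>a\<close> leads to \<open>A\<close> or \<open>C\<close>, and
  \<open>b\<close> to \<open>A\<close> or \<open>B\<close>. If both lead to \<open>A\<close>, the
  chain is a cycle; otherwise it joins two corners, and the brim triangles on the boundary between
  them go to one side. The second claim is about cutting off a single brim triangle.\<close>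

lemma tri_hat_cycles:
  assumes P: "P = {[t,a,b],[t,b,c],[t,c,a],[a,b,A],[b,c,B],[c,a,C],[A,B,b],[B,C,c],[C,A,a]}"
    and d: "distinct [t,a,b,c,A,B,C]"
  shows "\<not> ({a,b} \<in> E \<and> {b,c} \<in> E \<and> {c,a} \<in> E)"
    "\<not> ({b,A} \<in> E \<and> {b,B} \<in> E)"
    "\<not> ({a,A} \<in> E \<and> {b,A} \<in> E \<and> {a,b} \<in> E)"
    "\<not> ({a,A} \<in> E \<and> {b,B} \<in> E \<and> {a,b} \<in> E)"
    "\<not> ({a,C} \<in> E \<and> {b,A} \<in> E \<and> {a,b} \<in> E)"
    "\<not> ({a,C} \<in> E \<and> {b,B} \<in> E \<and> {a,b} \<in> E)"
    "\<not> ({a,A} \<in> E \<and> {b,A} \<in> E \<and> {b,c} \<in> E \<and> {c,a} \<in> E)"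
    "\<not> ({a,A} \<in> E \<and> {b,B} \<in> E \<and> {b,c} \<in> E \<and> {c,a} \<in> E)"
    "\<not> ({a,C} \<in> E \<and> {b,A} \<in> E \<and> {b,c} \<in> E \<and> {c,a} \<in> E)"
    "\<not> ({a,C} \<in> E \<and> {b,B} \<in> E \<and> {b,c} \<in> E \<and> {c,a} \<in> E)"
    "\<not> ({a,A} \<in> E \<and> {b,A} \<in> E \<and> {t,a} \<in> E \<and> {t,b} \<in> E)"
    "\<not> ({a,A} \<in> E \<and> {b,B} \<in> E \<and> {t,a} \<in> E \<and> {t,b} \<in> E)"
    "\<not> ({a,C} \<in> E \<and> {b,A} \<in> E \<and> {t,a} \<in> E \<and> {t,b} \<in> E)"
    "\<not> ({a,C} \<in> E \<and> {b,B} \<in> E \<and> {t,a} \<in> E \<and> {t,b} \<in> E)"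
proof -
  have d': "distinct [C,B,A,c,b,a,t]" using d by auto
  note s = doubleton_eq_iff poly_edges_simps Int_insert_left insert_commute
  show "\<not> ({a,b} \<in> E \<and> {b,c} \<in> E \<and> {c,a} \<in> E)"
    by (rule notI, rule no_separation[of "{{a,b},{b,c},{c,a}}"
      "{[t,a,b],[t,b,c],[t,c,a]}" "{[a,b,A],[b,c,B],[c,a,C],[A,B,b],[B,C,c],[C,A,a]}"])
      (use d d' in \<open>simp_all add: P s\<close>)
  show "\<not> ({b,A} \<in> E \<and> {b,B} \<in> E)"
    by (rule notI, rule no_separation[of "{{b,A},{b,B}}"
      "{[A,B,b]}" "{[t,a,b],[t,b,c],[t,c,a],[a,b,A],[b,c,B],[c,a,C],[B,C,c],[C,A,a]}"])
      (use d d' in \<open>simp_all add: P s\<close>)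
  show "\<not> ({a,A} \<in> E \<and> {b,A} \<in> E \<and> {a,b} \<in> E)"
    by (rule notI, rule no_separation[of "{{a,A},{b,A},{a,b}}"
      "{[a,b,A]}" "{[t,a,b],[t,b,c],[t,c,a],[b,c,B],[c,a,C],[A,B,b],[B,C,c],[C,A,a]}"])
      (use d d' in \<open>simp_all add: P s\<close>)
  show "\<not> ({a,A} \<in> E \<and> {b,B} \<in> E \<and> {a,b} \<in> E)"
    by (rule notI, rule no_separation[of "{{a,A},{b,B},{a,b}}"
      "{[a,b,A],[A,B,b]}" "{[t,a,b],[t,b,c],[t,c,a],[b,c,B],[c,a,C],[B,C,c],[C,A,a]}"])
      (use d d' in \<open>simp_all add: P s\<close>)
  show "\<not> ({a,C} \<in> E \<and> {b,A} \<in> E \<and> {a,b} \<in> E)"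
    by (rule notI, rule no_separation[of "{{a,C},{b,A},{a,b}}"
      "{[a,b,A],[C,A,a]}" "{[t,a,b],[t,b,c],[t,c,a],[b,c,B],[c,a,C],[A,B,b],[B,C,c]}"])
      (use d d' in \<open>simp_all add: P s\<close>)
  show "\<not> ({a,C} \<in> E \<and> {b,B} \<in> E \<and> {a,b} \<in> E)"
    by (rule notI, rule no_separation[of "{{a,C},{b,B},{a,b}}"
      "{[a,b,A],[C,A,a],[A,B,b]}" "{[t,a,b],[t,b,c],[t,c,a],[b,c,B],[c,a,C],[B,C,c]}"])
      (use d d' in \<open>simp_all add: P s\<close>)
  show "\<not> ({a,A} \<in> E \<and> {b,A} \<in> E \<and> {b,c} \<in> E \<and> {c,a} \<in> E)"
    by (rule notI, rule no_separation[of "{{a,A},{b,A},{b,c},{c,a}}"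
      "{[a,b,A],[t,a,b],[t,b,c],[t,c,a]}" "{[b,c,B],[c,a,C],[A,B,b],[B,C,c],[C,A,a]}"])
      (use d d' in \<open>simp_all add: P s\<close>)
  show "\<not> ({a,A} \<in> E \<and> {b,B} \<in> E \<and> {b,c} \<in> E \<and> {c,a} \<in> E)"
    by (rule notI, rule no_separation[of "{{a,A},{b,B},{b,c},{c,a}}"
      "{[a,b,A],[A,B,b],[t,a,b],[t,b,c],[t,c,a]}" "{[b,c,B],[c,a,C],[B,C,c],[C,A,a]}"])
      (use d d' in \<open>simp_all add: P s\<close>)
  show "\<not> ({a,C} \<in> E \<and> {b,A} \<in> E \<and> {b,c} \<in> E \<and> {c,a} \<in> E)"
    by (rule notI, rule no_separation[of "{{a,C},{b,A},{b,c},{c,a}}"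
      "{[a,b,A],[C,A,a],[t,a,b],[t,b,c],[t,c,a]}" "{[b,c,B],[c,a,C],[A,B,b],[B,C,c]}"])
      (use d d' in \<open>simp_all add: P s\<close>)
  show "\<not> ({a,C} \<in> E \<and> {b,B} \<in> E \<and> {b,c} \<in> E \<and> {c,a} \<in> E)"
    by (rule notI, rule no_separation[of "{{a,C},{b,B},{b,c},{c,a}}"
      "{[a,b,A],[C,A,a],[A,B,b],[t,a,b],[t,b,c],[t,c,a]}" "{[b,c,B],[c,a,C],[B,C,c]}"])
      (use d d' in \<open>simp_all add: P s\<close>)
  show "\<not> ({a,A} \<in> E \<and> {b,A} \<in> E \<and> {t,a} \<in> E \<and> {t,b} \<in> E)"
    by (rule notI, rule no_separation[of "{{a,A},{b,A},{t,a},{t,b}}"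
      "{[a,b,A],[t,a,b]}" "{[t,b,c],[t,c,a],[b,c,B],[c,a,C],[A,B,b],[B,C,c],[C,A,a]}"])
      (use d d' in \<open>simp_all add: P s\<close>)
  show "\<not> ({a,A} \<in> E \<and> {b,B} \<in> E \<and> {t,a} \<in> E \<and> {t,b} \<in> E)"
    by (rule notI, rule no_separation[of "{{a,A},{b,B},{t,a},{t,b}}"
      "{[a,b,A],[A,B,b],[t,a,b]}" "{[t,b,c],[t,c,a],[b,c,B],[c,a,C],[B,C,c],[C,A,a]}"])
      (use d d' in \<open>simp_all add: P s\<close>)
  show "\<not> ({a,C} \<in> E \<and> {b,A} \<in> E \<and> {t,a} \<in> E \<and> {t,b} \<in> E)"
    by (rule notI, rule no_separation[of "{{a,C},{b,A},{t,a},{t,b}}"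
      "{[a,b,A],[C,A,a],[t,a,b]}" "{[t,b,c],[t,c,a],[b,c,B],[c,a,C],[A,B,b],[B,C,c]}"])
      (use d d' in \<open>simp_all add: P s\<close>)
  show "\<not> ({a,C} \<in> E \<and> {b,B} \<in> E \<and> {t,a} \<in> E \<and> {t,b} \<in> E)"
    by (rule notI, rule no_separation[of "{{a,C},{b,B},{t,a},{t,b}}"
      "{[a,b,A],[C,A,a],[A,B,b],[t,a,b]}" "{[t,b,c],[t,c,a],[b,c,B],[c,a,C],[B,C,c]}"])
      (use d d' in \<open>simp_all add: P s\<close>)
qed

text \<open>Three fans exceed 2\<pi>: all faces at \<open>b\<close> without one or the other spike
  triangle, with angle 2\<pi> + \<alpha> - 2\<beta>, and the full turn opened at the edge to
  \<open>B\<close>, where \<beta> > 0 ensures \<alpha> > 0.\<close>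

lemma basic_hat_middle_vertex:
  assumes P: "{[t,a,b],[t,b,c],[a,b,B,A],[b,c,C,B]} \<subseteq> P"
    and d: "distinct [t,a,b,c,A,B,C]"
    and ang: "basic_hat_angles t a b c B \<alpha> \<beta>" and \<alpha>: "\<alpha> > 2 * \<beta>" "0 < \<beta>"
  shows "{b,c} \<in> E \<or> {b,B} \<in> E" "{a,b} \<in> E \<or> {b,B} \<in> E"
    "{b,B} \<in> E \<longrightarrow> {t,b} \<in> E \<or> {a,b} \<in> E \<or> {b,c} \<in> E"
proof -
  have d': "distinct [C,B,A,c,b,a,t]" using d by auto
  note s = doubleton_eq_iff poly_edges_simps All_less_Suc basic_hat_angles_def[THEN iffD1, OF ang]
  have "\<exists>j<length [[t,b,c],[b,c,C,B],[a,b,B,A]]. 0 < j \<and> {b, [t,c,B,a] ! j} \<in> E"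
    by (rule fan_cut) (use P d d' \<alpha> in \<open>simp_all add: s\<close>)
  thus "{b,c} \<in> E \<or> {b,B} \<in> E" by (auto simp: Ex_less_Suc)
  have "\<exists>j<length [[b,c,C,B],[a,b,B,A],[t,a,b]]. 0 < j \<and> {b, [c,B,a,t] ! j} \<in> E"
    by (rule fan_cut) (use P d d' \<alpha> in \<open>simp_all add: s\<close>)
  thus "{a,b} \<in> E \<or> {b,B} \<in> E" by (auto simp: Ex_less_Suc insert_commute)
  \<comment> \<open>\<open>B\<close> is both the first and the last direction, so the cut found here
    is not the one towards \<open>B\<close>.\<close>
  have "\<exists>j<length [[a,b,B,A],[t,a,b],[t,b,c],[b,c,C,B]]. 0 < j \<and> {b, [B,a,t,c,B] ! j} \<in> E"
    by (rule fan_cut) (use P d d' \<alpha> in \<open>simp_all add: s\<close>)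
  thus "{b,B} \<in> E \<longrightarrow> {t,b} \<in> E \<or> {a,b} \<in> E \<or> {b,c} \<in> E"
    by (auto simp: Ex_less_Suc insert_commute)
qed

lemma tri_hat_middle_vertex:
  assumes P: "{[t,a,b],[t,b,c],[a,b,A],[b,c,B],[A,B,b]} \<subseteq> P"
    and d: "distinct [t,a,b,c,A,B]"
    and ang: "tri_hat_angles t a b c A B \<alpha> \<beta> \<gamma>" and \<alpha>: "\<alpha> > 2 * \<beta> + \<gamma>" "0 \<le> 2 * \<beta> + \<gamma>"
    and cyc: "\<not> ({b,A} \<in> E \<and> {b,B} \<in> E)"
  shows "{b,c} \<in> E \<or> ({b,A} \<in> E \<or> {b,B} \<in> E)" "{a,b} \<in> E \<or> ({b,A} \<in> E \<or> {b,B} \<in> E)"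
    "({b,A} \<in> E \<or> {b,B} \<in> E) \<longrightarrow> {t,b} \<in> E \<or> {a,b} \<in> E \<or> {b,c} \<in> E"
proof -
  have d': "distinct [B,A,c,b,a,t]" using d by auto
  note s = doubleton_eq_iff poly_edges_simps All_less_Suc tri_hat_angles_def[THEN iffD1, OF ang] field_simps
  have "\<exists>j<length [[t,b,c],[b,c,B],[A,B,b],[a,b,A]]. 0 < j \<and> {b, [t,c,B,A,a] ! j} \<in> E"
    by (rule fan_cut) (use P d d' \<alpha> in \<open>simp_all add: s\<close>)
  thus "{b,c} \<in> E \<or> ({b,A} \<in> E \<or> {b,B} \<in> E)" by (auto simp: Ex_less_Suc)
  have "\<exists>j<length [[b,c,B],[A,B,b],[a,b,A],[t,a,b]]. 0 < j \<and> {b, [c,B,A,a,t] ! j} \<in> E"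
    by (rule fan_cut) (use P d d' \<alpha> in \<open>simp_all add: s\<close>)
  thus "{a,b} \<in> E \<or> ({b,A} \<in> E \<or> {b,B} \<in> E)" by (auto simp: Ex_less_Suc insert_commute)
  \<comment> \<open>Full turns opened at \<open>B\<close> and at \<open>A\<close>. By
    \<open>cyc\<close> at most one of these two edges is cut; the turn opened at a cut one yields a
    further cut towards \<open>a\<close>, \<open>t\<close> or \<open>c\<close>.\<close>
  have "\<exists>j<length [[A,B,b],[a,b,A],[t,a,b],[t,b,c],[b,c,B]]. 0 < j \<and> {b, [B,A,a,t,c,B] ! j} \<in> E"
    by (rule fan_cut) (use P d d' \<alpha> in \<open>simp_all add: s\<close>)
  moreover have "\<exists>j<length [[a,b,A],[t,a,b],[t,b,c],[b,c,B],[A,B,b]]. 0 < j \<and> {b, [A,a,t,c,B,A] ! j} \<in> E"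
    by (rule fan_cut) (use P d d' \<alpha> in \<open>simp_all add: s\<close>)
  ultimately show "({b,A} \<in> E \<or> {b,B} \<in> E) \<longrightarrow> {t,b} \<in> E \<or> {a,b} \<in> E \<or> {b,c} \<in> E"
    using cyc by (auto simp: Ex_less_Suc insert_commute)
qed

lemma basic_hat_no_unfolding:
  assumes P: "P = {[t,a,b],[t,b,c],[t,c,a],[a,b,B,A],[b,c,C,B],[c,a,A,C]}"
    and d: "distinct [t,a,b,c,A,B,C]"
    and ang: "basic_hat_angles t c a b A \<alpha> \<beta>" "basic_hat_angles t a b c B \<alpha> \<beta>" "basic_hat_angles t b c a C \<alpha> \<beta>"
    and \<alpha>: "\<alpha> > 2 * \<beta>" "0 < \<beta>"
  shows False
proof -
  \<comment> \<open>Rotating the labels preserves the set of face lists, so facts for one position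
    hold for all three.\<close>
  have P1: "P = {[t,b,c],[t,c,a],[t,a,b],[b,c,C,B],[c,a,A,C],[a,b,B,A]}"
    and P2: "P = {[t,c,a],[t,a,b],[t,b,c],[c,a,A,C],[a,b,B,A],[b,c,C,B]}" using P by auto
  have d1: "distinct [t,b,c,a,B,C,A]" and d2: "distinct [t,c,a,b,C,A,B]" using d by auto
  have "{[t,c,a],[t,a,b],[c,a,A,C],[a,b,B,A]} \<subseteq> P" "{[t,a,b],[t,b,c],[a,b,B,A],[b,c,C,B]} \<subseteq> P"
    "{[t,b,c],[t,c,a],[b,c,C,B],[c,a,A,C]} \<subseteq> P" by (simp_all add: P)
  note a = basic_hat_middle_vertex[OF this(1) d2 ang(1) \<alpha>] and b = basic_hat_middle_vertex[OF this(2) d ang(2) \<alpha>]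
    and c = basic_hat_middle_vertex[OF this(3) d1 ang(3) \<alpha>]
  note s = basic_hat_cycles[OF P d] and s1 = basic_hat_cycles[OF P1 d1] and s2 = basic_hat_cycles[OF P2 d2]
  show False
    by (rule hat_cut_contradiction[OF a b c s(1) s(2) s1(2) s2(2) s(3) s1(3) s2(3) s(4)])
qed

lemma tri_hat_no_unfolding:
  assumes P: "P = {[t,a,b],[t,b,c],[t,c,a],[a,b,A],[b,c,B],[c,a,C],[A,B,b],[B,C,c],[C,A,a]}"
    and d: "distinct [t,a,b,c,A,B,C]"
    and ang: "tri_hat_angles t c a b C A \<alpha> \<beta> \<gamma>" "tri_hat_angles t a b c A B \<alpha> \<beta> \<gamma>"
      "tri_hat_angles t b c a B C \<alpha> \<beta> \<gamma>"
    and \<alpha>: "\<alpha> > 2 * \<beta> + \<gamma>" "0 \<le> 2 * \<beta> + \<gamma>"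
  shows False
proof -
  have P1: "P = {[t,b,c],[t,c,a],[t,a,b],[b,c,B],[c,a,C],[a,b,A],[B,C,c],[C,A,a],[A,B,b]}"
    and P2: "P = {[t,c,a],[t,a,b],[t,b,c],[c,a,C],[a,b,A],[b,c,B],[C,A,a],[A,B,b],[B,C,c]}" using P by auto
  have d1: "distinct [t,b,c,a,B,C,A]" and d2: "distinct [t,c,a,b,C,A,B]" using d by auto
  have d': "distinct [t,a,b,c,A,B]" "distinct [t,b,c,a,B,C]" "distinct [t,c,a,b,C,A]" using d by auto
  note s = tri_hat_cycles[OF P d] and s1 = tri_hat_cycles[OF P1 d1] and s2 = tri_hat_cycles[OF P2 d2]
  have "{[t,c,a],[t,a,b],[c,a,C],[a,b,A],[C,A,a]} \<subseteq> P" "{[t,a,b],[t,b,c],[a,b,A],[b,c,B],[A,B,b]} \<subseteq> P"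
    "{[t,b,c],[t,c,a],[b,c,B],[c,a,C],[B,C,c]} \<subseteq> P" by (simp_all add: P)
  note a = tri_hat_middle_vertex[OF this(1) d'(3) ang(1) \<alpha> s2(2)]
    and b = tri_hat_middle_vertex[OF this(2) d'(1) ang(2) \<alpha> s(2)]
    and c = tri_hat_middle_vertex[OF this(3) d'(2) ang(3) \<alpha> s1(2)]
  \<comment> \<open>The four versions of a chain combine, since it only matters that some corner
    edge is cut at each end.\<close>
  have k1: "\<not> (({a,C} \<in> E \<or> {a,A} \<in> E) \<and> ({b,A} \<in> E \<or> {b,B} \<in> E) \<and> {a,b} \<in> E)"
    using s(3-6) by blast
  have k2: "\<not> (({b,A} \<in> E \<or> {b,B} \<in> E) \<and> ({c,B} \<in> E \<or> {c,C} \<in> E) \<and> {b,c} \<in> E)"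
    using s1(3-6) by blast
  have k3: "\<not> (({c,B} \<in> E \<or> {c,C} \<in> E) \<and> ({a,C} \<in> E \<or> {a,A} \<in> E) \<and> {c,a} \<in> E)"
    using s2(3-6) by blast
  have k4: "\<not> (({a,C} \<in> E \<or> {a,A} \<in> E) \<and> ({b,A} \<in> E \<or> {b,B} \<in> E) \<and> {b,c} \<in> E \<and> {c,a} \<in> E)"
    using s(7-10) by blast
  have k5: "\<not> (({b,A} \<in> E \<or> {b,B} \<in> E) \<and> ({c,B} \<in> E \<or> {c,C} \<in> E) \<and> {c,a} \<in> E \<and> {a,b} \<in> E)"
    using s1(7-10) by blast
  have k6: "\<not> (({c,B} \<in> E \<or> {c,C} \<in> E) \<and> ({a,C} \<in> E \<or> {a,A} \<in> E) \<and> {a,b} \<in> E \<and> {b,c} \<in> E)"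
    using s2(7-10) by blast
  have k7: "\<not> (({a,C} \<in> E \<or> {a,A} \<in> E) \<and> ({b,A} \<in> E \<or> {b,B} \<in> E) \<and> {t,a} \<in> E \<and> {t,b} \<in> E)"
    using s(11-14) by blast
  show False
    by (rule hat_cut_contradiction[OF a b c s(1) k1 k2 k3 k4 k5 k6 k7])
qed

end

section \<open>Distinctness of the vertices of a hat\<close>

lemma polyhedron_edge_three_faces:
  assumes "is_polyhedron P" "e \<in> poly_edges F" "e \<in> poly_edges G" "e \<in> poly_edges H"
    "{F, G, H} \<subseteq> P" "distinct [F, G, H]"
  shows False
proof -
  have "{F, G, H} \<subseteq> faces_with_edge P e" using assms by (auto simp: faces_with_edge_def)
  moreover have "finite (faces_with_edge P e)"
    using assms(1) by (auto simp: is_polyhedron_def faces_with_edge_def)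
  ultimately have "card {F, G, H} \<le> card (faces_with_edge P e)" by (simp add: card_mono)
  moreover have "card (faces_with_edge P e) \<le> 2" using assms(1) by (auto simp: is_polyhedron_def)
  moreover have "card {F, G, H} = 3" using assms(6) by simp
  ultimately show False by simp
qed

text \<open>Vertices of a common face are distinct because the face is simple. The tip shares no
  face with a corner; if they coincided, an edge from the tip to a middle vertex would lie in a
  third face, from the brim.\<close>

lemma basic_hat_distinct:
  assumes P: "P = {[t,a,b],[t,b,c],[t,c,a],[a,b,B,A],[b,c,C,B],[c,a,A,C]}" and poly: "is_polyhedron P"
  shows "distinct [t,a,b,c,A,B,C]"
proof -
  have *: "distinct F" if "F \<in> P" for F using poly that by (auto simp: is_polyhedron_def simple_polygon_def)
  have d: "distinct [t,a,b]" "distinct [t,b,c]" "distinct [t,c,a]" "distinct [a,b,B,A]"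
    "distinct [b,c,C,B]" "distinct [c,a,A,C]" by (rule *; simp add: P)+
  have "t \<noteq> A"
    by (rule notI, rule polyhedron_edge_three_faces[OF poly, of "{t,a}" "[t,a,b]" "[t,c,a]" "[a,b,B,A]"])
      (use d in \<open>auto simp: P poly_edges_simps\<close>)
  moreover have "t \<noteq> B"
    by (rule notI, rule polyhedron_edge_three_faces[OF poly, of "{t,b}" "[t,a,b]" "[t,b,c]" "[a,b,B,A]"])
      (use d in \<open>auto simp: P poly_edges_simps\<close>)
  moreover have "t \<noteq> C"
    by (rule notI, rule polyhedron_edge_three_faces[OF poly, of "{t,c}" "[t,b,c]" "[t,c,a]" "[b,c,C,B]"])
      (use d in \<open>auto simp: P poly_edges_simps\<close>)
  ultimately show ?thesis using d by auto
qed

text \<open>Here a middle vertex and the opposite corner also share no face; if they coincided, a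
  spike base edge would lie in three faces.\<close>

lemma tri_hat_distinct:
  assumes P: "P = {[t,a,b],[t,b,c],[t,c,a],[a,b,A],[b,c,B],[c,a,C],[A,B,b],[B,C,c],[C,A,a]}"
    and poly: "is_polyhedron P"
  shows "distinct [t,a,b,c,A,B,C]"
proof -
  have *: "distinct F" if "F \<in> P" for F using poly that by (auto simp: is_polyhedron_def simple_polygon_def)
  have d: "distinct [t,a,b]" "distinct [t,b,c]" "distinct [t,c,a]" "distinct [a,b,A]" "distinct [b,c,B]"
    "distinct [c,a,C]" "distinct [A,B,b]" "distinct [B,C,c]" "distinct [C,A,a]" by (rule *; simp add: P)+
  have "t \<noteq> A"
    by (rule notI, rule polyhedron_edge_three_faces[OF poly, of "{t,a}" "[t,a,b]" "[t,c,a]" "[a,b,A]"])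
      (use d in \<open>auto simp: P poly_edges_simps\<close>)
  moreover have "t \<noteq> B"
    by (rule notI, rule polyhedron_edge_three_faces[OF poly, of "{t,b}" "[t,a,b]" "[t,b,c]" "[b,c,B]"])
      (use d in \<open>auto simp: P poly_edges_simps\<close>)
  moreover have "t \<noteq> C"
    by (rule notI, rule polyhedron_edge_three_faces[OF poly, of "{t,c}" "[t,b,c]" "[t,c,a]" "[c,a,C]"])
      (use d in \<open>auto simp: P poly_edges_simps\<close>)
  moreover have "c \<noteq> A"
    by (rule notI, rule polyhedron_edge_three_faces[OF poly, of "{b,c}" "[t,b,c]" "[b,c,B]" "[a,b,A]"])
      (use d in \<open>auto simp: P poly_edges_simps\<close>)
  moreover have "a \<noteq> B"
    by (rule notI, rule polyhedron_edge_three_faces[OF poly, of "{c,a}" "[t,c,a]" "[c,a,C]" "[b,c,B]"])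
      (use d in \<open>auto simp: P poly_edges_simps\<close>)
  moreover have "b \<noteq> C"
    by (rule notI, rule polyhedron_edge_three_faces[OF poly, of "{a,b}" "[t,a,b]" "[a,b,A]" "[c,a,C]"])
      (use d in \<open>auto simp: P poly_edges_simps\<close>)
  ultimately show ?thesis using d by auto
qed

section \<open>Assembly for the two kinds of hats\<close>

lemma all_less_3: "(\<forall>i<3. Q i) \<longleftrightarrow> Q 0 \<and> Q (Suc 0) \<and> Q (2::nat)"
  by (auto simp: numeral_3_eq_3 numeral_2_eq_2 less_Suc_eq)

lemma Collect_less_3: "{g i |i. i < 3} = {g 0, g (Suc 0), g (2::nat)}"
  by (auto simp: numeral_3_eq_3 numeral_2_eq_2 less_Suc_eq)

lemma open_convex_no_unfolding:
  assumes poly: "is_polyhedron P" and conv: "\<And>F. F \<in> P \<Longrightarrow> convex_polygon F"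
    and b: "F \<in> P" "e \<in> poly_edges F" "\<And>G. G \<in> P \<Longrightarrow> e \<in> poly_edges G \<Longrightarrow> G = F"
    and no: "\<And>E f. unfolded_polyhedron P E f \<Longrightarrow> False"
  shows "is_polyhedron P \<and> open_polyhedron P \<and> convex_faced P \<and> \<not> has_edge_unfolding P"
proof -
  have "faces_with_edge P e = {F}" unfolding faces_with_edge_def using b by blast
  moreover have "e \<in> polyhedron_edges P" unfolding polyhedron_edges_def using b by blast
  ultimately have "e \<in> boundary_edges P" by (simp add: boundary_edges_def)
  moreover have "convex_faced P"
    using conv convex_polygon_interior_angle by (auto simp: convex_faced_def)
  moreover have "\<not> has_edge_unfolding P"
  proof
    assume "has_edge_unfolding P"
    then obtain E where E: "E \<subseteq> polyhedron_edges P" "cutting P (\<Union>e\<in>E. convex hull e)"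
      by (auto simp: has_edge_unfolding_def edge_cutting_def)
    then obtain f where "unfolding_map P (\<Union>e\<in>E. convex hull e) f"
      by (auto simp: cutting_def)
    hence "unfolded_polyhedron P E f"
      using poly conv E by unfold_locales (simp_all add: cutting_def)
    thus False by (rule no)
  qed
  ultimately show ?thesis using poly by (auto simp: open_polyhedron_def)
qed

text \<open>Co-interior angles at parallel sides: scaling replaces the bottom side by the top side,
  and reversing the leg gives the supplement.\<close>

lemma trapezoid_top_angle:
  fixes a b A B :: "'a::real_inner"
  assumes "A - B = l *\<^sub>R (a - b)" "0 < l" "vangle (b - B) (A - B) = \<beta>"
  shows "vangle (B - b) (a - b) = pi - \<beta>" "vangle (a - b) (B - b) = pi - \<beta>"
proof -
  have "vangle (b - B) (a - b) = \<beta>" using assms by (simp add: vangle_scaleR)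
  thus "vangle (B - b) (a - b) = pi - \<beta>" using vangle_minus[of "b - B" "a - b"] by simp
  thus "vangle (a - b) (B - b) = pi - \<beta>" by (simp add: vangle_commute)
qed

lemma simple_triangle_not_collinear: "simple_polygon [x, y, z] \<Longrightarrow> \<not> collinear {x, y, z}"
  by (simp add: simple_polygon_def collinear_aff_dim)

theorem theorem8:
  fixes t :: "real^3" and m c :: "nat \<Rightarrow> real^3" and \<alpha> \<beta> \<gamma> l :: real
    and P :: "(real^3) list set"
  assumes "(basic_hat t m c \<alpha> \<beta> l \<and> \<gamma> = 0 \<and> P = basic_hat_faces t m c \<and> \<alpha> > 2 * \<beta> + \<gamma>)
         \<or> (triangulated_hat t m c \<alpha> \<beta> \<gamma> \<and> P = tri_hat_faces t m c \<and> \<alpha> > 2 * \<beta> + \<gamma>)"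
  shows "is_polyhedron P \<and> open_polyhedron P \<and> convex_faced P \<and> \<not> has_edge_unfolding P"
  using assms
proof (elim disjE conjE)
  assume hat: "basic_hat t m c \<alpha> \<beta> l" and "\<gamma> = 0" and "P = basic_hat_faces t m c" and "\<alpha> > 2 * \<beta> + \<gamma>"
  define x y z X Y Z where vs: "x = m 0" "y = m (Suc 0)" "z = m 2" "X = c 0" "Y = c (Suc 0)" "Z = c 2"
  have P: "P = {[t,x,y],[t,y,z],[t,z,x],[x,y,Y,X],[y,z,Z,Y],[z,x,X,Z]}"
    using \<open>P = basic_hat_faces t m c\<close>
    by (simp add: basic_hat_faces_def spike_faces_def Collect_less_3 vs numeral_2_eq_2 insert_commute)
  have poly: "is_polyhedron P" and l: "l > 1" and "pi / 6 \<le> \<beta>"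
    using hat \<open>P = basic_hat_faces t m c\<close> by (simp_all add: basic_hat_def)
  hence \<beta>: "0 < \<beta>" using pi_gt_zero by linarith
  have spike: "vangle (t - x) (y - x) = \<alpha>" "vangle (t - y) (x - y) = \<alpha>" "vangle (t - y) (z - y) = \<alpha>"
    "vangle (t - z) (y - z) = \<alpha>" "vangle (t - z) (x - z) = \<alpha>" "vangle (t - x) (z - x) = \<alpha>"
    using hat by (simp_all add: basic_hat_def spike_ok_def all_less_3 Let_def vs numeral_2_eq_2)
  have par: "Y - X = l *\<^sub>R (y - x)" "Z - Y = l *\<^sub>R (z - y)" "X - Z = l *\<^sub>R (x - z)"
    using hat by (simp_all add: basic_hat_def all_less_3 Let_def vs numeral_2_eq_2)
  have base: "vangle (m i - c i) (c (Suc i mod 3) - c i) = \<beta> \<and>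
      vangle (m (Suc i mod 3) - c (Suc i mod 3)) (c i - c (Suc i mod 3)) = \<beta>" if "i < 3" for i
    using hat that unfolding basic_hat_def Let_def by blast
  have brim: "vangle (x - X) (Y - X) = \<beta>" "vangle (y - Y) (X - Y) = \<beta>" "vangle (y - Y) (Z - Y) = \<beta>"
    "vangle (z - Z) (Y - Z) = \<beta>" "vangle (z - Z) (X - Z) = \<beta>" "vangle (x - X) (Z - X) = \<beta>"
    using base[of 0] base[of "Suc 0"] base[of 2] by (simp_all add: vs numeral_2_eq_2)
  \<comment> \<open>Reading each trapezoid from its other end provides the second top angle.\<close>
  have par': "X - Y = l *\<^sub>R (x - y)" "Y - Z = l *\<^sub>R (y - z)" "Z - X = l *\<^sub>R (z - x)"
    using par by (metis minus_diff_eq scaleR_minus_right)+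
  note top = trapezoid_top_angle[OF par(1) _ brim(1)] trapezoid_top_angle[OF par(2) _ brim(3)]
    trapezoid_top_angle[OF par(3) _ brim(5)] trapezoid_top_angle[OF par'(1) _ brim(2)]
    trapezoid_top_angle[OF par'(2) _ brim(4)] trapezoid_top_angle[OF par'(3) _ brim(6)]
  have simple: "simple_polygon F" if "F \<in> P" for F using poly that by (simp add: is_polyhedron_def)
  note d = basic_hat_distinct[OF P poly]
  show ?thesis
  proof (rule open_convex_no_unfolding[OF poly])
    show "convex_polygon F" if "F \<in> P" for F
      using that simple[OF that] l par unfolding P
      by (auto intro: convex_polygon_triangle
            convex_polygon_trapezoid[where l = l])
    \<comment> \<open>A side between two corners lies in a single brim face and so is a boundary
      edge.\<close>
    show "[x,y,Y,X] \<in> P" "{X,Y} \<in> poly_edges [x,y,Y,X]"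
      by (auto simp: P poly_edges_simps)
    show "G = [x,y,Y,X]" if "G \<in> P" "{X,Y} \<in> poly_edges G" for G
      using that d by (auto simp: P poly_edges_simps doubleton_eq_iff)
    show False if "unfolded_polyhedron P E f" for E f
    proof -
      interpret unfolded_polyhedron P E f by fact
      show False
        by (rule basic_hat_no_unfolding[OF P d, of \<alpha> \<beta>])
          (use spike top l \<beta> \<open>\<gamma> = 0\<close> \<open>\<alpha> > 2 * \<beta> + \<gamma>\<close> in
            \<open>simp_all add: basic_hat_angles_def vangle_commute[of _ "t - _"]\<close>)
    qed
  qed
next
  assume hat: "triangulated_hat t m c \<alpha> \<beta> \<gamma>" and "P = tri_hat_faces t m c" and "\<alpha> > 2 * \<beta> + \<gamma>"
  define x y z X Y Z where vs: "x = m 0" "y = m (Suc 0)" "z = m 2" "X = c 0" "Y = c (Suc 0)" "Z = c 2"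
  have P: "P = {[t,x,y],[t,y,z],[t,z,x],[x,y,X],[y,z,Y],[z,x,Z],[X,Y,y],[Y,Z,z],[Z,X,x]}"
    using \<open>P = tri_hat_faces t m c\<close>
    by (simp add: tri_hat_faces_def spike_faces_def Collect_less_3 vs numeral_2_eq_2 insert_commute)
  have poly: "is_polyhedron P" and "pi / 6 \<le> \<beta> + \<gamma> / 2"
    using hat \<open>P = tri_hat_faces t m c\<close> by (simp_all add: triangulated_hat_def)
  hence \<beta>: "0 \<le> 2 * \<beta> + \<gamma>" using pi_gt_zero by linarith
  have spike: "vangle (t - x) (y - x) = \<alpha>" "vangle (t - y) (x - y) = \<alpha>" "vangle (t - y) (z - y) = \<alpha>"
    "vangle (t - z) (y - z) = \<alpha>" "vangle (t - z) (x - z) = \<alpha>" "vangle (t - x) (z - x) = \<alpha>"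
    using hat by (simp_all add: triangulated_hat_def spike_ok_def all_less_3 Let_def vs numeral_2_eq_2)
  have dist: "dist X x = dist X y" "dist Y y = dist Y z" "dist Z z = dist Z x"
    and apex: "vangle (x - X) (y - X) = \<gamma>" "vangle (y - Y) (z - Y) = \<gamma>" "vangle (z - Z) (x - Z) = \<gamma>"
    using hat by (simp_all add: triangulated_hat_def all_less_3 Let_def vs numeral_2_eq_2)
  have base: "vangle (y - X) (Y - X) = \<beta>" "vangle (y - Y) (X - Y) = \<beta>" "vangle (z - Y) (Z - Y) = \<beta>"
    "vangle (z - Z) (Y - Z) = \<beta>" "vangle (x - Z) (X - Z) = \<beta>" "vangle (x - X) (Z - X) = \<beta>"
    using hat by (simp_all add: triangulated_hat_def all_less_3 Let_def vs numeral_2_eq_2)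
  have simple: "simple_polygon F" if "F \<in> P" for F using poly that by (simp add: is_polyhedron_def)
  have "simple_polygon [x,y,X]" "simple_polygon [y,z,Y]" "simple_polygon [z,x,Z]"
    "simple_polygon [X,Y,y]" "simple_polygon [Y,Z,z]" "simple_polygon [Z,X,x]"
    by (auto intro!: simple simp: P)
  note nc = this[THEN simple_triangle_not_collinear]
  have nc': "\<not> collinear {X,x,y}" "\<not> collinear {Y,y,z}" "\<not> collinear {Z,z,x}"
    "\<not> collinear {X,y,x}" "\<not> collinear {Y,z,y}" "\<not> collinear {Z,x,z}"
    using nc(1-3) by (simp_all add: insert_commute)
  \<comment> \<open>Each triangle on a spike base edge appears twice, with the ends of its base
    swapped, to obtain both base angles.\<close>
  note small = isosceles_base_angle[OF nc'(1) dist(1) apex(1)] isosceles_base_angle[OF nc'(2) dist(2) apex(2)]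
    isosceles_base_angle[OF nc'(3) dist(3) apex(3)]
    isosceles_base_angle[OF nc'(4) dist(1)[symmetric] apex(1)[unfolded vangle_commute[of "x - X"]]]
    isosceles_base_angle[OF nc'(5) dist(2)[symmetric] apex(2)[unfolded vangle_commute[of "y - Y"]]]
    isosceles_base_angle[OF nc'(6) dist(3)[symmetric] apex(3)[unfolded vangle_commute[of "z - Z"]]]
  note big = equal_base_angles_apex[OF nc(4) base(1,2)] equal_base_angles_apex[OF nc(5) base(3,4)]
    equal_base_angles_apex[OF nc(6) base(5,6)]
  note d = tri_hat_distinct[OF P poly]
  show ?thesis
  proof (rule open_convex_no_unfolding[OF poly])
    show "convex_polygon F" if "F \<in> P" for F
      using that simple[OF that] unfolding P by (auto intro: convex_polygon_triangle)
    show "[X,Y,y] \<in> P" "{X,Y} \<in> poly_edges [X,Y,y]"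
      by (auto simp: P poly_edges_simps)
    show "G = [X,Y,y]" if "G \<in> P" "{X,Y} \<in> poly_edges G" for G
      using that d by (auto simp: P poly_edges_simps doubleton_eq_iff)
    show False if "unfolded_polyhedron P E f" for E f
    proof -
      interpret unfolded_polyhedron P E f by fact
      have angles: "tri_hat_angles t z x y Z X \<alpha> \<beta> \<gamma>" "tri_hat_angles t x y z X Y \<alpha> \<beta> \<gamma>"
        "tri_hat_angles t y z x Y Z \<alpha> \<beta> \<gamma>"
        unfolding tri_hat_angles_def using spike small big by (auto simp: vangle_commute)
      show False
        by (rule tri_hat_no_unfolding[OF P d angles]) (use \<beta> \<open>\<alpha> > 2 * \<beta> + \<gamma>\<close> in simp_all)
    qed
  qed
qed

end
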